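(* Let $N\ge\ell\ge 2$ and $k\ge1$ be integers, and let $\sigma=p_1\cdots p_k$, where $p_1,\dots,p_k$ are independent, each uniformly random among the $(N-1)!$ cycles of length $N$ in $S_N$. Let $p_{A_2}(N,\ell;k)$ be the probability that all elements of $\{1,\dots,\ell\}$ lie in the same cycle of $\sigma$. Then \[ p_{A_2}(N,\ell;k)=\frac{1}{\ell}\binom{N}{\ell}^{-1}\sum_{\lambda_1=1}^{N}(-1)^{(k+1)(N-\lambda_1)}\binom{N-1}{\lambda_1-1}^{-k+1}\left\{1_{\{\lambda_1<N\}}\left[\binom{N-1}{\ell-1}-\binom{N-\lambda_1-1}{\ell-1}\right]+1_{\{\lambda_1=N\}}\binom{N}{\ell}\right\}. \]
   Context: $1_{\{\cdot\}}$ denotes the indicator of the condition. Binomial coefficients $\binom{a}{b}$ with $a\ge0$ vanish for $b>a$. *)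

theory Defs
  imports "HOL-Probability.Probability" "HOL-Combinatorics.Orbits"
begin

text \<open>
  The symmetric group on \<open>N\<close> letters is represented by the functions on \<^typ>\<open>nat\<close> that
  permute \<open>{1..N}\<close> (and hence fix everything else).
\<close>

definition long_cycles :: "nat \<Rightarrow> (nat \<Rightarrow> nat) set" where
  "long_cycles N = {p. p permutes {1..N} \<and> cyclic_on p {1..N}}"

text \<open>
  The values of \<open>p\<close> outside \<open>{1..k}\<close> are irrelevant; \<^const>\<open>Pi_pmf\<close> needs a default for them,
  which is chosen to be \<^const>\<open>id\<close>.
\<close>

definition long_cycle_tuple :: "nat \<Rightarrow> nat \<Rightarrow> (nat \<Rightarrow> nat \<Rightarrow> nat) pmf" where
  "long_cycle_tuple N k = Pi_pmf {1..k} id (\<lambda>_. pmf_of_set (long_cycles N))"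

text \<open>\<open>perm_product k p = p 1 \<circ> p 2 \<circ> \<dots> \<circ> p k\<close>\<close>

definition perm_product :: "nat \<Rightarrow> (nat \<Rightarrow> 'a \<Rightarrow> 'a) \<Rightarrow> 'a \<Rightarrow> 'a" where
  "perm_product k p = foldr (\<circ>) (map p [1..<Suc k]) id"

text \<open>
  Cycles are identified with their underlying sets; fixed points count as cycles of length 1.
\<close>

definition in_same_cycle :: "('a \<Rightarrow> 'a) \<Rightarrow> 'a set \<Rightarrow> bool" where
  "in_same_cycle \<sigma> A \<longleftrightarrow> (\<exists>C. cyclic_on \<sigma> C \<and> A \<subseteq> C)"

definition p_A2 :: "nat \<Rightarrow> nat \<Rightarrow> nat \<Rightarrow> real" where
  "p_A2 N l k =
     measure_pmf.prob (long_cycle_tuple N k) {p. in_same_cycle (perm_product k p) {1..l}}"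

end

theory Submission
  imports Defs
begin

text \<open>
  Up to normalisation, multiplying by a uniformly random long cycle is an operator on functions on
  the symmetric group which has the hook characters as eigenfunctions, the one of the hook
  \<open>(N - r, 1\<^sup>r)\<close> having eigenvalue \<open>(-1)\<^sup>r / binom(N - 1, r)\<close>. The indicator of the long cycles
  is an alternating sum of these characters, so the distribution of \<open>\<sigma>\<close> is explicit, and it remains
  to sum each hook character over the permutations with \<open>1, \<dots>, l\<close> in one cycle.

  No representation theory is needed: the hook characters are the alternating partial sums of the
  traces of a permutation on the exterior powers of the permutation representation, and such a trace
  is a sum of principal minors of the permutation matrix. A long cycle \<open>c\<close> that maps \<open>A\<close> to
  \<open>A - {x} \<union> {y}\<close> is the transposition of \<open>x\<close> and \<open>y\<close> after a cycle on \<open>A\<close> and a cycle on the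
  complement of \<open>A\<close>; all other sets \<open>A\<close> cancel from the average over \<open>c\<close>. What is left, a sum over
  transpositions, is evaluated by a sign-reversing bijection.
\<close>

hide_const (open) Finite_Cartesian_Product.transpose

subsection \<open>Invariant sets and cycles\<close>

text \<open>Why alternating partial sums appear: let \<open>e\<close> be the sum of all basis
  vectors and \<open>n = card S\<close>. Exterior multiplication by \<open>e\<close> and contraction
  with \<open>e\<close> anticommute to multiplication by \<open>n\<close>, and permutations fix
  \<open>e\<close> and so commute with both. The composite of the two is the sum of all
  \<open>a_y^* a_x\<close>. Its off-diagonal part is what averaging over long cycles produces, up to
  a scalar; its diagonal part is multiplication by the degree. Moving one operator around the trace
  shows that the trace of \<open>p\<close> with this composite in degree \<open>r + 1\<close> is
  \<open>n\<close> times the exterior trace of degree \<open>r\<close> minus the same quantity in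
  degree \<open>r\<close>, a recursion solved by alternating sums of exterior traces. The exterior
  traces themselves are in general not eigenfunctions: the average of one of them combines two
  consecutive hook characters with different eigenvalues. All this is carried out with sums over
  subsets and bijections, signs of restrictions taking the place of the exterior algebra.\<close>

definition cycles_on :: "'a set \<Rightarrow> ('a \<Rightarrow> 'a) set" where
  "cycles_on A = {p. p permutes A \<and> cyclic_on p A}"

lemma image_orbit:
  assumes "permutation p"
  shows "p ` orbit p x = orbit p x"
  using orbit_inverse[of x p p p] permutation_self_in_orbit[OF assms, of x]
    permutation_orbit_step[OF assms, of x] by simp

lemma orbit_subset_invariant:
  assumes "p ` T \<subseteq> T" "x \<in> T"
  shows "orbit p x \<subseteq> T"
proof
  fix y assume "y \<in> orbit p x"
  then show "y \<in> T" using assms by induction auto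
qed

text \<open>Orbits are awkward to follow when a permutation is multiplied by a transposition,
  whereas invariance of a set is a statement about images; hence cycles are tested on invariant
  sets. The restriction \<open>q\<close> makes the orbit lemmas for permutations applicable, as
  \<open>p\<close> is arbitrary outside \<open>S\<close>.\<close>

lemma cyclic_on_iff_invariant:
  assumes "finite S" "bij_betw p S S"
  shows "cyclic_on p S \<longleftrightarrow> S \<noteq> {} \<and> (\<forall>T\<subseteq>S. p ` T = T \<longrightarrow> T = {} \<or> T = S)"
proof -
  define q where "q = restrict_id p S"
  have q: "q permutes S"
    unfolding q_def by (rule permutes_restrict_id) (rule assms(2))
  then have perm: "permutation q"
    using assms(1) permutes_imp_permutation by blast
  have cyc: "cyclic_on p S \<longleftrightarrow> cyclic_on q S"
    by (rule cyclic_cong) (simp add: q_def)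
  have im: "p ` T = q ` T" if "T \<subseteq> S" for T
    using that by (intro image_cong) (auto simp: q_def)
  have "cyclic_on q S \<longleftrightarrow> S \<noteq> {} \<and> (\<forall>T\<subseteq>S. q ` T = T \<longrightarrow> T = {} \<or> T = S)"
  proof (intro iffI conjI allI impI)
    assume "cyclic_on q S" then show "S \<noteq> {}" by (simp add: cyclic_on_alldef)
  next
    fix T assume "cyclic_on q S" "T \<subseteq> S" "q ` T = T"
    moreover have "S \<subseteq> T" if "x \<in> T" for x
      using orbit_subset_invariant[of q T x] calculation that unfolding cyclic_on_alldef by blast
    ultimately show "T = {} \<or> T = S" by blast
  next
    assume *: "S \<noteq> {} \<and> (\<forall>T\<subseteq>S. q ` T = T \<longrightarrow> T = {} \<or> T = S)"
    then obtain s where "s \<in> S" by auto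
    then have "orbit q s = S"
      using * permutes_orbit_subset[OF q] image_orbit[OF perm] orbit_nonempty by metis
    then show "cyclic_on q S" using \<open>s \<in> S\<close> by (auto simp: cyclic_on_def)
  qed
  with cyc im show ?thesis by auto
qed

text \<open>An orbit is the least invariant set through any of its points, so the orbit of a point
  of \<open>L\<close> contains \<open>L\<close> iff no invariant set separates points of
  \<open>L\<close>.\<close>

lemma in_same_cycle_iff_invariant:
  assumes "permutation p" "L \<noteq> {}"
  shows "in_same_cycle p L \<longleftrightarrow> (\<forall>T. p ` T = T \<longrightarrow> T \<inter> L \<noteq> {} \<longrightarrow> L \<subseteq> T)"
proof
  assume "in_same_cycle p L"
  then obtain C where C: "cyclic_on p C" "L \<subseteq> C" by (auto simp: in_same_cycle_def)
  show "\<forall>T. p ` T = T \<longrightarrow> T \<inter> L \<noteq> {} \<longrightarrow> L \<subseteq> T"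
  proof (intro allI impI)
    fix T assume "p ` T = T" "T \<inter> L \<noteq> {}"
    then obtain x where "x \<in> T" "x \<in> L" by auto
    then have "orbit p x \<subseteq> T" using \<open>p ` T = T\<close> by (intro orbit_subset_invariant) auto
    with C \<open>x \<in> L\<close> show "L \<subseteq> T" by (auto simp: cyclic_on_alldef)
  qed
next
  assume *: "\<forall>T. p ` T = T \<longrightarrow> T \<inter> L \<noteq> {} \<longrightarrow> L \<subseteq> T"
  obtain x where x: "x \<in> L" using assms(2) by auto
  then have "x \<in> orbit p x \<inter> L" using permutation_self_in_orbit[OF assms(1)] by auto
  then have "L \<subseteq> orbit p x" using * image_orbit[OF assms(1), of x] by blast
  then show "in_same_cycle p L"
    unfolding in_same_cycle_def using cyclic_on_orbit'[OF assms(1)] by blast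
qed

section \<open>Permutations preserving the blocks of a partition, and gluing two cycles\<close>

lemma image_eq_complement:
  assumes "inj p" "p ` (A \<union> B) = A \<union> B" "p ` A = A" "A \<inter> B = {}"
  shows "p ` B = B"
proof -
  have "p ` B = p ` ((A \<union> B) - A)" using assms(4) by (intro arg_cong[where f = "image p"]) auto
  also have "\<dots> = (A \<union> B) - A" using assms by (simp add: image_set_diff)
  finally show ?thesis using assms(4) by auto
qed

lemma bij_betw_permutes_comp:
  assumes "A \<inter> B = {}"
  shows "bij_betw (\<lambda>(f, g). f \<circ> g) ({f. f permutes A} \<times> {g. g permutes B})
           {h. h permutes (A \<union> B) \<and> h ` A = A}"
proof (rule bij_betw_byWitness[where f' = "\<lambda>h. (restrict_id h A, restrict_id h B)"])
  show "\<forall>a\<in>{f. f permutes A} \<times> {g. g permutes B}.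
      (restrict_id ((\<lambda>(f, g). f \<circ> g) a) A, restrict_id ((\<lambda>(f, g). f \<circ> g) a) B) = a"
  proof
    fix z assume "z \<in> {f. f permutes A} \<times> {g. g permutes B}"
    then obtain f g where z: "z = (f, g)" and fg: "f permutes A" "g permutes B" by blast
    have "restrict_id (f \<circ> g) A = f"
    proof
      fix x show "restrict_id (f \<circ> g) A x = f x"
        using assms permutes_not_in[OF fg(1), of x] permutes_not_in[OF fg(2), of x]
        by (cases "x \<in> A") (auto simp: disjoint_iff)
    qed
    moreover have "restrict_id (f \<circ> g) B = g"
    proof
      fix x show "restrict_id (f \<circ> g) B x = g x"
        using assms permutes_not_in[OF fg(1), of "g x"] permutes_not_in[OF fg(2), of x]
          permutes_in_image[OF fg(2), of x]
        by (cases "x \<in> B") (auto simp: disjoint_iff)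
    qed
    ultimately show "(restrict_id ((\<lambda>(f, g). f \<circ> g) z) A, restrict_id ((\<lambda>(f, g). f \<circ> g) z) B) = z"
      by (simp add: z)
  qed
next
  show "\<forall>h\<in>{h. h permutes A \<union> B \<and> h ` A = A}.
      (\<lambda>(f, g). f \<circ> g) (restrict_id h A, restrict_id h B) = h"
  proof
    fix h assume "h \<in> {h. h permutes A \<union> B \<and> h ` A = A}"
    then have h: "h permutes A \<union> B" "h ` A = A" by auto
    have hB: "h ` B = B"
      using image_eq_complement[OF permutes_inj[OF h(1)] permutes_image[OF h(1)] h(2) assms] .
    have "(restrict_id h A \<circ> restrict_id h B) x = h x" for x
      using hB assms permutes_not_in[OF h(1), of x] unfolding restrict_id_def by auto
    then show "(\<lambda>(f, g). f \<circ> g) (restrict_id h A, restrict_id h B) = h" by (auto simp: fun_eq_iff)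
  qed
next
  show "(\<lambda>(f, g). f \<circ> g) ` ({f. f permutes A} \<times> {g. g permutes B})
      \<subseteq> {h. h permutes A \<union> B \<and> h ` A = A}"
  proof clarify
    fix f g assume fg: "f permutes A" "g permutes B"
    have "(f \<circ> g) permutes A \<union> B"
      using fg by (intro permutes_compose) (auto intro: permutes_subset)
    moreover have "g ` A = A"
      using assms permutes_not_in[OF fg(2)] by (auto simp: image_iff disjoint_iff)
    ultimately show "f \<circ> g permutes A \<union> B \<and> (f \<circ> g) ` A = A"
      using permutes_image[OF fg(1)] by (metis image_comp)
  qed
next
  show "(\<lambda>h. (restrict_id h A, restrict_id h B)) ` {h. h permutes A \<union> B \<and> h ` A = A}
      \<subseteq> {f. f permutes A} \<times> {g. g permutes B}"
  proof (rule image_subsetI)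
    fix h assume "h \<in> {h. h permutes A \<union> B \<and> h ` A = A}"
    then have h: "h permutes A \<union> B" "h ` A = A" by auto
    have hB: "h ` B = B"
      using image_eq_complement[OF permutes_inj[OF h(1)] permutes_image[OF h(1)] h(2) assms] .
    show "(restrict_id h A, restrict_id h B) \<in> {f. f permutes A} \<times> {g. g permutes B}"
      using h hB permutes_inj_on[OF h(1)] by (auto intro!: permutes_restrict_id simp: bij_betw_def)
  qed
qed

lemma image_transpose:
  assumes "x \<in> T" "y \<notin> T"
  shows "transpose x y ` T = insert y (T - {x})"
proof -
  have "transpose x y ` (T - {x}) = id ` (T - {x})"
    using assms by (intro image_cong) (auto intro!: transpose_apply_other)
  moreover have "transpose x y ` T = insert (transpose x y x) (transpose x y ` (T - {x}))"
    using assms(1) by (metis image_insert insert_Diff)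
  ultimately show ?thesis by simp
qed

text \<open>As \<open>transpose x y\<close> is an involution, \<open>T\<close> is invariant under
  the composite iff \<open>p\<close> and the transposition have the same image of \<open>T\<close>.
  If \<open>T\<close> contains both or neither of \<open>x\<close> and \<open>y\<close>, this is
  invariance under \<open>p\<close>. If it contains just one, say \<open>x\<close>, then the
  injection \<open>p\<close> would map the finite set \<open>T \<inter> A\<close> into
  \<open>T \<inter> A - {x}\<close>, which is impossible.\<close>

lemma cyclic_on_transpose_comp:
  assumes fin: "finite A" "finite B" and AB: "A \<inter> B = {}" and xy: "x \<in> A" "y \<in> B"
    and p: "p permutes A \<union> B" "p ` A = A"
  shows "cyclic_on (transpose x y \<circ> p) (A \<union> B) \<longleftrightarrow> cyclic_on p A \<and> cyclic_on p B"
proof -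
  let ?t = "transpose x y"
  have pB: "p ` B = B"
    using image_eq_complement[OF permutes_inj[OF p(1)] permutes_image[OF p(1)] p(2) AB] .
  have inj: "inj p" using permutes_inj[OF p(1)] .
  have bA: "bij_betw p A A" and bB: "bij_betw p B B"
    using p(2) pB inj by (auto simp: bij_betw_def intro: inj_on_subset)
  have tp: "(?t \<circ> p) permutes A \<union> B"
    using p(1) xy by (intro permutes_compose) (auto intro: permutes_swap_id)
  have eqA: "cyclic_on p A \<longleftrightarrow> (\<forall>T\<subseteq>A. p ` T = T \<longrightarrow> T = {} \<or> T = A)"
    using cyclic_on_iff_invariant[OF fin(1) bA] xy by auto
  have eqB: "cyclic_on p B \<longleftrightarrow> (\<forall>T\<subseteq>B. p ` T = T \<longrightarrow> T = {} \<or> T = B)"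
    using cyclic_on_iff_invariant[OF fin(2) bB] xy by auto
  have eqAB: "cyclic_on (?t \<circ> p) (A \<union> B) \<longleftrightarrow>
      (\<forall>T\<subseteq>A \<union> B. (?t \<circ> p) ` T = T \<longrightarrow> T = {} \<or> T = A \<union> B)"
    using cyclic_on_iff_invariant[OF _ permutes_imp_bij[OF tp]] fin xy by auto
  have tinv: "(?t \<circ> p) ` T = T \<longleftrightarrow> p ` T = ?t ` T" for T
  proof
    assume "(?t \<circ> p) ` T = T"
    then have "?t ` (?t ` (p ` T)) = ?t ` T" by (metis image_comp)
    then show "p ` T = ?t ` T" by (simp add: image_comp)
  next
    assume "p ` T = ?t ` T"
    then have "?t ` (p ` T) = T" by (simp add: image_comp)
    then show "(?t \<circ> p) ` T = T" by (metis image_comp)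
  qed
  have small: False
    if fT: "finite T" and T: "p ` T \<subseteq> T - {z}" "z \<in> T" for T z
  proof -
    have "card T = card (p ` T)" using inj by (simp add: card_image inj_on_subset)
    also have "\<dots> \<le> card (T - {z})" using fT T by (intro card_mono) auto
    also have "\<dots> < card T" using fT T by (intro card_Diff1_less) auto
    finally show False by simp
  qed
  show ?thesis
  proof
    assume c: "cyclic_on (?t \<circ> p) (A \<union> B)"
    \<comment> \<open>An invariant part of a block that contains \<open>x\<close> or
      \<open>y\<close> is replaced by its complement in the block, so it suffices to treat sets that
      avoid both points.\<close>
    have gen: "T = {}" if T: "T \<subseteq> A \<union> B" "p ` T = T" "x \<notin> T" "y \<notin> T" for T
    proof -
      have "(?t \<circ> p) ` T = T" using tinv transpose_image_eq[of x T y] T by simp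
      then show ?thesis using c T xy unfolding eqAB by auto
    qed
    have "T = {} \<or> T = A" if T: "T \<subseteq> A" "p ` T = T" for T
    proof (cases "x \<in> T")
      case True
      have "p ` (A - T) = A - T" using p(2) T(2) inj by (simp add: image_set_diff)
      then have "A - T = {}" using gen[of "A - T"] True xy AB by auto
      then show ?thesis using T by auto
    next
      case False then show ?thesis using gen[of T] T xy AB by auto
    qed
    moreover have "T = {} \<or> T = B" if T: "T \<subseteq> B" "p ` T = T" for T
    proof (cases "y \<in> T")
      case True
      have "p ` (B - T) = B - T" using pB T(2) inj by (simp add: image_set_diff)
      then have "B - T = {}" using gen[of "B - T"] True xy AB by auto
      then show ?thesis using T by auto
    next
      case False then show ?thesis using gen[of T] T xy AB by auto
    qed
    ultimately show "cyclic_on p A \<and> cyclic_on p B" using eqA eqB by blast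
  next
    assume c: "cyclic_on p A \<and> cyclic_on p B"
    have int: "p ` (T \<inter> A) = p ` T \<inter> A" "p ` (T \<inter> B) = p ` T \<inter> B" for T
      using p(2) pB inj by (simp_all add: image_Int)
    have "T = {} \<or> T = A \<union> B" if T: "T \<subseteq> A \<union> B" "(?t \<circ> p) ` T = T" for T
    proof -
      have pT: "p ` T = ?t ` T" using T tinv by simp
      have fT: "finite T" using T fin by (auto intro: finite_subset)
      have "x \<in> T \<longleftrightarrow> y \<in> T"
      proof (rule ccontr)
        assume "\<not> (x \<in> T \<longleftrightarrow> y \<in> T)"
        then consider "x \<in> T" "y \<notin> T" | "y \<in> T" "x \<notin> T" by auto
        then show False
        proof cases
          case 1
          then have "p ` (T \<inter> A) \<subseteq> T \<inter> A - {x}"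
            unfolding int pT using image_transpose[OF 1] xy AB by auto
          then show False using small[of "T \<inter> A" x] fT 1 xy by auto
        next
          case 2
          then have "p ` (T \<inter> B) \<subseteq> T \<inter> B - {y}"
            unfolding int pT using image_transpose[OF 2] xy AB by (auto simp: transpose_commute)
          then show False using small[of "T \<inter> B" y] fT 2 xy by auto
        qed
      qed
      then have "p ` T = T" using pT transpose_image_eq[of x T y] by simp
      then have "T \<inter> A = {} \<or> T \<inter> A = A" "T \<inter> B = {} \<or> T \<inter> B = B"
        using c eqA eqB int[of T] by simp_all
      then show ?thesis using \<open>x \<in> T \<longleftrightarrow> y \<in> T\<close> xy T by auto
    qed
    then show "cyclic_on (?t \<circ> p) (A \<union> B)" using eqAB by blast
  qed
qed

text \<open>This parametrises the long cycles that contribute to the average of a minor. Composing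
  such a cycle with \<open>transpose x y\<close> moves \<open>y\<close> back to \<open>x\<close>, so
  that \<open>A\<close> becomes invariant; by the gluing lemma the result is a pair of cycles, and
  composing once more undoes the step.\<close>

lemma bij_betw_cycles_on_split:
  assumes fin: "finite A" "finite B" and AB: "A \<inter> B = {}" and xy: "x \<in> A" "y \<in> B"
  shows "bij_betw (\<lambda>(a, b). transpose x y \<circ> (a \<circ> b)) (cycles_on A \<times> cycles_on B)
           {c \<in> cycles_on (A \<union> B). c ` A = insert y (A - {x})}"
proof -
  let ?t = "transpose x y"
  have "bij_betw (\<lambda>(f, g). f \<circ> g) (cycles_on A \<times> cycles_on B)
      {h. h permutes (A \<union> B) \<and> h ` A = A \<and> cyclic_on h A \<and> cyclic_on h B}"
  proof -
    let ?P = "{f. f permutes A} \<times> {g. g permutes B}"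
    have "bij_betw (\<lambda>(f, g). f \<circ> g) (cycles_on A \<times> cycles_on B)
       {h \<in> {h. h permutes (A \<union> B) \<and> h ` A = A}. cyclic_on h A \<and> cyclic_on h B}"
    proof -
      have 1: "cycles_on A \<times> cycles_on B = {z \<in> ?P. cyclic_on (fst z) A \<and> cyclic_on (snd z) B}"
        by (auto simp: cycles_on_def)
      have 2: "(cyclic_on (fst z) A \<and> cyclic_on (snd z) B) \<longleftrightarrow>
          (cyclic_on ((\<lambda>(f, g). f \<circ> g) z) A \<and> cyclic_on ((\<lambda>(f, g). f \<circ> g) z) B)" if zP: "z \<in> ?P" for z
      proof -
        obtain f g where z: "z = (f, g)" "f permutes A" "g permutes B" using zP by blast
        have "cyclic_on f A \<longleftrightarrow> cyclic_on (f \<circ> g) A"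
          using AB permutes_not_in[OF z(3)] by (intro cyclic_cong) (auto simp: disjoint_iff)
        moreover have "cyclic_on g B \<longleftrightarrow> cyclic_on (f \<circ> g) B"
        proof (rule cyclic_cong)
          fix s assume "s \<in> B"
          then have "g s \<notin> A" using AB permutes_in_image[OF z(3)] by auto
          then show "g s = (f \<circ> g) s" using permutes_not_in[OF z(2)] by simp
        qed
        ultimately show ?thesis by (simp add: z(1))
      qed
      have B: "bij_betw (\<lambda>(f, g). f \<circ> g) ?P {h. h permutes (A \<union> B) \<and> h ` A = A}"
        by (rule bij_betw_permutes_comp[OF AB])
      show ?thesis unfolding 1
        by (rule bij_betw_Collect[OF B]) (rule 2[symmetric])
    qed
    then show ?thesis by simp
  qed
  moreover have "bij_betw (\<lambda>h. ?t \<circ> h)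
      {h. h permutes (A \<union> B) \<and> h ` A = A \<and> cyclic_on h A \<and> cyclic_on h B}
      {c \<in> cycles_on (A \<union> B). c ` A = insert y (A - {x})}"
  proof (rule bij_betw_byWitness[where f' = "\<lambda>h. ?t \<circ> h"])
    have tA: "?t ` A = insert y (A - {x})" "?t ` insert y (A - {x}) = A"
    proof -
      show "?t ` A = insert y (A - {x})" using image_transpose[of x A y] xy AB by auto
      moreover have "?t ` (?t ` A) = A" by (simp add: image_comp)
      ultimately show "?t ` insert y (A - {x}) = A" by simp
    qed
    have tp: "(?t \<circ> h) permutes A \<union> B" if "h permutes A \<union> B" for h
      using that xy by (intro permutes_compose) (auto intro: permutes_swap_id)
    have tt: "?t \<circ> (?t \<circ> h) = h" for h :: "'a \<Rightarrow> 'a" by (simp add: o_assoc)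
    show "(\<lambda>h. ?t \<circ> h) ` {h. h permutes (A \<union> B) \<and> h ` A = A \<and> cyclic_on h A \<and> cyclic_on h B}
        \<subseteq> {c \<in> cycles_on (A \<union> B). c ` A = insert y (A - {x})}"
    proof (rule image_subsetI)
      fix h assume "h \<in> {h. h permutes (A \<union> B) \<and> h ` A = A \<and> cyclic_on h A \<and> cyclic_on h B}"
      then have h: "h permutes A \<union> B" "h ` A = A" "cyclic_on h A" "cyclic_on h B" by auto
      have "(?t \<circ> h) ` A = insert y (A - {x})"
        using h(2) tA(1) by (metis image_comp)
      then show "?t \<circ> h \<in> {c \<in> cycles_on (A \<union> B). c ` A = insert y (A - {x})}"
        using cyclic_on_transpose_comp[OF fin AB xy h(1,2)] tp[OF h(1)] h(3,4)
        by (simp add: cycles_on_def)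
    qed
    show "(\<lambda>h. ?t \<circ> h) ` {c \<in> cycles_on (A \<union> B). c ` A = insert y (A - {x})}
        \<subseteq> {h. h permutes (A \<union> B) \<and> h ` A = A \<and> cyclic_on h A \<and> cyclic_on h B}"
    proof (rule image_subsetI)
      fix c assume "c \<in> {c \<in> cycles_on (A \<union> B). c ` A = insert y (A - {x})}"
      then have c: "c permutes A \<union> B" "cyclic_on c (A \<union> B)" "c ` A = insert y (A - {x})"
        by (auto simp: cycles_on_def)
      have "(?t \<circ> c) ` A = A" using c(3) tA(2) by (metis image_comp)
      then show "?t \<circ> c \<in> {h. h permutes (A \<union> B) \<and> h ` A = A \<and> cyclic_on h A \<and> cyclic_on h B}"
        using cyclic_on_transpose_comp[OF fin AB xy tp[OF c(1)]] tp[OF c(1)] c(2) tt[of c] by simp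
    qed
  qed (auto simp: o_assoc)
  ultimately have "bij_betw ((\<lambda>h. ?t \<circ> h) \<circ> (\<lambda>(f, g). f \<circ> g)) (cycles_on A \<times> cycles_on B)
           {c \<in> cycles_on (A \<union> B). c ` A = insert y (A - {x})}"
    by (rule bij_betw_trans)
  then show ?thesis by (simp add: comp_def case_prod_unfold)
qed

section \<open>Number and sign of the cycles on a finite set\<close>

lemma finite_cycles_on: "finite A \<Longrightarrow> finite (cycles_on A)"
  unfolding cycles_on_def by (rule finite_subset[OF _ finite_permutations]) auto

lemma cycles_on_singleton: "cycles_on {a} = {id}"
  using orbit_eq_singleton_iff[of id a] by (auto simp: cycles_on_def cyclic_on_def)

lemma cycles_on_apply_neq:
  assumes "c \<in> cycles_on S" "x \<in> S" "S \<noteq> {x}"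
  shows "c x \<in> S - {x}"
proof -
  have "c x \<noteq> x"
    using assms orbit_eq_singleton_iff[of c x] by (auto simp: cycles_on_def cyclic_on_alldef)
  then show ?thesis using assms by (auto simp: cycles_on_def permutes_in_image)
qed

text \<open>The case \<open>A = {x}\<close> of the splitting: a cycle on \<open>insert x F\<close>
  arises from one on \<open>F\<close> by inserting \<open>x\<close> just before \<open>y\<close>. It
  drives the inductions for the number and the sign of the cycles.\<close>

lemma bij_betw_cycles_on_insert:
  assumes "finite F" "x \<notin> F" "y \<in> F"
  shows "bij_betw (\<lambda>b. transpose x y \<circ> b) (cycles_on F) {c \<in> cycles_on (insert x F). c x = y}"
proof -
  have 1: "bij_betw (\<lambda>(a, b). transpose x y \<circ> (a \<circ> b)) ({id} \<times> cycles_on F)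
      {c \<in> cycles_on (insert x F). c x = y}"
    using bij_betw_cycles_on_split[of "{x}" F x y] assms by (simp add: cycles_on_singleton)
  have 2: "bij_betw (\<lambda>b. (id, b)) (cycles_on F) ({id} \<times> cycles_on F)"
    by (auto simp: bij_betw_def inj_on_def)
  show ?thesis using bij_betw_trans[OF 2 1] by (simp add: comp_def)
qed

lemma cycles_on_insert:
  assumes "finite F" "F \<noteq> {}" "x \<notin> F"
  shows "cycles_on (insert x F) = (\<Union>y\<in>F. {c \<in> cycles_on (insert x F). c x = y})"
  using cycles_on_apply_neq[of _ "insert x F" x] assms by auto

lemma card_cycles_on:
  assumes "finite A" "A \<noteq> {}"
  shows "card (cycles_on A) = fact (card A - 1)"
  using assms
proof (induction A rule: finite_ne_induct)
  case (singleton x)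
  then show ?case by (simp add: cycles_on_singleton)
next
  case (insert x F)
  have "card (cycles_on (insert x F)) = (\<Sum>y\<in>F. card {c \<in> cycles_on (insert x F). c x = y})"
    by (subst cycles_on_insert[OF insert(1,2,3)], subst card_UN_disjoint)
      (use insert finite_cycles_on[of "insert x F"] in auto)
  also have "\<dots> = (\<Sum>y\<in>F. fact (card F - 1))"
    using insert bij_betw_same_card[OF bij_betw_cycles_on_insert[OF insert(1,3)]]
    by (intro sum.cong) auto
  also have "\<dots> = card F * fact (card F - 1)" by simp
  also have "\<dots> = fact (card F)"
    using insert by (metis card_gt_0_iff fact_reduce of_nat_id)
  finally show ?case using insert by simp
qed

lemma sign_cycles_on:
  assumes "finite A" "A \<noteq> {}" "c \<in> cycles_on A"
  shows "sign c = (-1) ^ (card A - 1)"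
  using assms
proof (induction A arbitrary: c rule: finite_ne_induct)
  case (singleton x)
  then show ?case by (simp add: cycles_on_singleton)
next
  case (insert x F)
  define y where "y = c x"
  have y: "y \<in> F"
    unfolding y_def using cycles_on_apply_neq[OF insert.prems, of x] insert by auto
  have "c \<in> {c \<in> cycles_on (insert x F). c x = y}" using insert by (simp add: y_def)
  then obtain b where b: "b \<in> cycles_on F" "c = transpose x y \<circ> b"
    using bij_betw_imp_surj_on[OF bij_betw_cycles_on_insert[OF insert(1,3) y]] by auto
  have "permutation b"
    using b insert by (auto simp: cycles_on_def intro: permutes_imp_permutation)
  then have "sign c = - sign b"
    using b y insert by (auto simp: sign_compose sign_swap_id permutation_swap_id)
  also have "\<dots> = - ((-1) ^ (card F - 1))" using insert.IH b by simp
  also have "\<dots> = (-1) ^ Suc (card F - 1)" by simp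
  also have "Suc (card F - 1) = card (insert x F) - 1"
    using insert by (simp add: card_gt_0_iff)
  finally show ?case .
qed

subsection \<open>Exterior powers and averages over long cycles\<close>

text \<open>
  The principal minor of the permutation matrix of \<open>p\<close> on the rows and columns in \<open>A\<close>.
\<close>

definition pminor :: "('a \<Rightarrow> 'a) \<Rightarrow> 'a set \<Rightarrow> int" where
  "pminor p A = (if p ` A = A then sign_on A p else 0)"

lemma pminor_cong: "(\<And>z. z \<in> A \<Longrightarrow> f z = g z) \<Longrightarrow> pminor f A = pminor g A"
  unfolding pminor_def by (simp cong: image_cong)

lemma pminor_comp:
  assumes "finite A" "inj g" "g ` A = A"
  shows "pminor (f \<circ> g) A = pminor f A * sign_on A g"
proof -
  have fg: "(f \<circ> g) ` A = f ` A" using assms(3) by (metis image_comp)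
  show ?thesis
  proof (cases "f ` A = A")
    case True
    then have "bij_betw f A A" using assms(1) by (simp add: finite_surj_inj bij_betw_def)
    moreover have "bij_betw g A A" using assms(2,3) by (auto simp: bij_betw_def intro: inj_on_subset)
    ultimately have "sign_on A (f \<circ> g) = sign_on A f * sign_on A g"
      using assms(1) by (rule sign_on_compose)
    then show ?thesis
      using True unfolding pminor_def fg by metis
  next
    case False
    then show ?thesis unfolding pminor_def fg by simp
  qed
qed

text \<open>
  The trace of \<open>p\<close> on the \<open>r\<close>-th exterior power of the permutation representation; the analogous
  sum \<open>swap_trace\<close> takes the trace of \<open>p\<close> composed with \<open>\<Sum>\<^sub>x\<^sub>\<noteq>\<^sub>y a\<^sub>y\<^sup>* a\<^sub>x\<close>, where \<open>a\<^sub>x\<close> and \<open>a\<^sub>x\<^sup>*\<close> are the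
  contraction and the exterior multiplication with the basis vector \<open>x\<close>.
\<close>

definition ext_trace :: "'a set \<Rightarrow> nat \<Rightarrow> ('a \<Rightarrow> 'a) \<Rightarrow> int" where
  "ext_trace S r p = (\<Sum>A | A \<subseteq> S \<and> card A = r. pminor p A)"

definition swap_trace :: "'a set \<Rightarrow> nat \<Rightarrow> ('a \<Rightarrow> 'a) \<Rightarrow> int" where
  "swap_trace S r p =
     (\<Sum>A | A \<subseteq> S \<and> card A = r. \<Sum>x\<in>A. \<Sum>y\<in>S - A. pminor (p \<circ> transpose x y) A)"

lemma bij_betw_conj_cycles_on:
  assumes "x \<in> S" "y \<in> S"
  shows "bij_betw (\<lambda>c. transpose x y \<circ> c \<circ> transpose x y) (cycles_on S) (cycles_on S)"
proof (rule bij_betw_byWitness[where f' = "\<lambda>c. transpose x y \<circ> c \<circ> transpose x y"])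
  have "transpose x y \<circ> c \<circ> transpose x y \<in> cycles_on S" if "c \<in> cycles_on S" for c
  proof -
    have "cyclic_on (transpose x y \<circ> c \<circ> transpose x y) (transpose x y ` S)"
      using that by (intro cyclic_on_image) (auto simp: cycles_on_def)
    moreover have "(transpose x y \<circ> c \<circ> transpose x y) permutes S"
      using that assms by (auto simp: cycles_on_def intro!: permutes_compose permutes_swap_id)
    ultimately show ?thesis using assms by (simp add: cycles_on_def)
  qed
  then show "(\<lambda>c. transpose x y \<circ> c \<circ> transpose x y) ` cycles_on S \<subseteq> cycles_on S"
    "(\<lambda>c. transpose x y \<circ> c \<circ> transpose x y) ` cycles_on S \<subseteq> cycles_on S" by auto
qed (auto simp: fun_eq_iff)

lemma image_permutes_comp_eq_iff:
  assumes "p permutes S"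
  shows "(p \<circ> g) ` A = A \<longleftrightarrow> g ` A = inv p ` A"
proof -
  have "(p \<circ> g) ` A = p ` (g ` A)" by (simp add: image_comp)
  moreover have "A = p ` (inv p ` A)" using permutes_inverses[OF assms] by (simp add: image_image)
  ultimately show ?thesis using inj_image_eq_iff[OF permutes_inj[OF assms]] by metis
qed

text \<open>
  If \<open>A - B\<close> contains two points, where \<open>B\<close> is the preimage of \<open>A\<close> under \<open>p\<close>, then conjugating the
  cycle by their transposition reverses the sign of the minor.
\<close>

lemma sum_cycles_pminor:
  assumes S: "finite S" and p: "p permutes S" and A: "A \<subseteq> S" "A \<noteq> {}" "A \<noteq> S"
  shows "(\<Sum>c\<in>cycles_on S. pminor (p \<circ> c) A) =
    (-1) ^ (card A - 1) * fact (card A - 1) * fact (card S - card A - 1) *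
      (\<Sum>x\<in>A. \<Sum>y\<in>S - A. pminor (p \<circ> transpose x y) A)"
proof -
  define B where "B = inv p ` A"
  have pinv: "(p \<circ> g) ` A = A \<longleftrightarrow> g ` A = B" for g
    unfolding B_def by (rule image_permutes_comp_eq_iff[OF p])
  have fA: "finite A" using A S by (auto intro: finite_subset)
  have cB: "card B = card A"
    unfolding B_def by (intro card_image permutes_inj_on[OF permutes_inv[OF p]])
  have fB: "finite B" using fA by (simp add: B_def)
  have BS: "B \<subseteq> S"
    unfolding B_def using A permutes_image[OF permutes_inv[OF p]] by blast
  have pm0: "pminor (p \<circ> g) A = 0" if "g ` A \<noteq> B" for g
    using that pinv[of g] by (simp add: pminor_def)
  have tA: "transpose x y ` A = insert y (A - {x})" if "x \<in> A" "y \<in> S - A" for x y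
    using that by (intro image_transpose) auto
  \<comment> \<open>\<open>A\<close> and \<open>B\<close> have the same size, hence so do
    \<open>A - B\<close> and \<open>B - A\<close>; the cases are size 0, 1 and at least 2.\<close>
  consider "B = A" | x y where "x \<in> A" "y \<in> S - A" "B = insert y (A - {x})"
    | x y where "x \<in> A - B" "y \<in> A - B" "x \<noteq> y"
  proof (cases "card (A - B) \<ge> 2")
    case True
    then obtain T where "T \<subseteq> A - B" "card T = 2" using obtain_subset_with_card_n by metis
    then show ?thesis using that(3) by (auto simp: card_2_iff)
  next
    case False
    have eq: "card (A - B) = card (B - A)"
      using cB fA fB card_Diff_subset_Int[of A B] card_Diff_subset_Int[of B A]
      by (simp add: Int_commute)
    from False consider "card (A - B) = 0" | "card (A - B) = 1" by linarith
    then show ?thesis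
    proof cases
      case 1
      then have "A - B = {}" "B - A = {}" using eq fA fB by (metis card_0_eq finite_Diff)+
      then show ?thesis using that(1) by blast
    next
      case 2
      then obtain x y where "A - B = {x}" "B - A = {y}" using eq by (metis card_1_singletonE)
      then show ?thesis using that(2)[of x y] BS by blast
    qed
  qed
  then show ?thesis
  proof cases
    case 1
    \<comment> \<open>Both sides vanish: a cycle on \<open>S\<close> preserves no proper nonempty
      subset, and transposing a point of \<open>A\<close> with one outside moves
      \<open>A\<close>.\<close>
    have "pminor (p \<circ> c) A = 0" if c: "c \<in> cycles_on S" for c
    proof (rule pm0)
      have "bij_betw c S S" using c by (auto simp: cycles_on_def permutes_imp_bij)
      then show "c ` A \<noteq> B"
        using c A 1 cyclic_on_iff_invariant[OF S, of c] by (auto simp: cycles_on_def)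
    qed
    moreover have "pminor (p \<circ> transpose x y) A = 0" if "x \<in> A" "y \<in> S - A" for x y
      using tA[OF that] that 1 by (intro pm0) auto
    ultimately show ?thesis by simp
  next
    case (2 x y)
    \<comment> \<open>The set \<open>insert y (A - {x})\<close> determines \<open>x\<close> and
      \<open>y\<close>, so just one of the transpositions maps \<open>A\<close> onto
      \<open>B\<close>.\<close>
    have "(\<Sum>x'\<in>A. \<Sum>y'\<in>S - A. pminor (p \<circ> transpose x' y') A) =
        (\<Sum>x'\<in>A. \<Sum>y'\<in>S - A. if x' = x \<and> y' = y then pminor (p \<circ> transpose x y) A else 0)"
    proof (intro sum.cong refl)
      fix x' y' assume xy': "x' \<in> A" "y' \<in> S - A"
      have "x' = x \<and> y' = y" if "insert y' (A - {x'}) = insert y (A - {x})"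
      proof -
        have "x' \<in> insert y' (A - {x'}) \<longleftrightarrow> x' \<in> insert y (A - {x})"
          "y' \<in> insert y' (A - {x'}) \<longleftrightarrow> y' \<in> insert y (A - {x})" using that by simp_all
        then show ?thesis using xy' 2 by auto
      qed
      then show "pminor (p \<circ> transpose x' y') A =
          (if x' = x \<and> y' = y then pminor (p \<circ> transpose x y) A else 0)"
        using tA[OF xy'] 2(3) pm0[of "transpose x' y'"] by auto
    qed
    also have "\<dots> = (\<Sum>x'\<in>A. if x' = x then pminor (p \<circ> transpose x y) A else 0)"
    proof (intro sum.cong refl)
      fix x' assume "x' \<in> A"
      show "(\<Sum>y'\<in>S - A. if x' = x \<and> y' = y then pminor (p \<circ> transpose x y) A else 0) =
          (if x' = x then pminor (p \<circ> transpose x y) A else 0)"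
        using 2 S by (cases "x' = x") simp_all
    qed
    also have "\<dots> = pminor (p \<circ> transpose x y) A" using 2 fA by simp
    finally have R: "(\<Sum>x'\<in>A. \<Sum>y'\<in>S - A. pminor (p \<circ> transpose x' y') A) =
        pminor (p \<circ> transpose x y) A" .
    have Sdec: "A \<union> (S - A) = S" using A by auto
    have fD: "finite (S - A)" using S by simp
    have bij: "bij_betw (\<lambda>(a, b). transpose x y \<circ> (a \<circ> b)) (cycles_on A \<times> cycles_on (S - A))
           {c \<in> cycles_on S. c ` A = B}"
      using bij_betw_cycles_on_split[OF fA fD _ 2(1,2)] 2(3) Sdec by auto
    have "(\<Sum>c\<in>cycles_on S. pminor (p \<circ> c) A) =
        (\<Sum>c\<in>{c \<in> cycles_on S. c ` A = B}. pminor (p \<circ> c) A)"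
      using finite_cycles_on[OF S] by (intro sum.mono_neutral_right) (auto intro: pm0)
    also have "\<dots> = (\<Sum>(a, b)\<in>cycles_on A \<times> cycles_on (S - A).
        pminor (p \<circ> (transpose x y \<circ> (a \<circ> b))) A)"
      by (subst sum.reindex_bij_betw[OF bij, symmetric]) (simp add: case_prod_unfold)
    also have "\<dots> = (\<Sum>(a, b)\<in>cycles_on A \<times> cycles_on (S - A).
        pminor (p \<circ> transpose x y) A * (-1) ^ (card A - 1))"
    proof (intro sum.cong refl, clarify)
      fix a b assume ab: "a \<in> cycles_on A" "b \<in> cycles_on (S - A)"
      then have a: "a permutes A" and b: "b permutes (S - A)" by (auto simp: cycles_on_def)
      \<comment> \<open>The cycle \<open>b\<close> fixes \<open>A\<close> pointwise, so it affects
        the number of terms but not the minor.\<close>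
      have "pminor (p \<circ> (transpose x y \<circ> (a \<circ> b))) A = pminor ((p \<circ> transpose x y) \<circ> a) A"
        using permutes_not_in[OF b] by (intro pminor_cong) simp
      also have "\<dots> = pminor (p \<circ> transpose x y) A * sign_on A a"
        using fA permutes_inj[OF a] permutes_image[OF a] by (rule pminor_comp)
      also have "sign_on A a = sign a" using a by (intro sign_on_permutes) auto
      also have "\<dots> = (-1) ^ (card A - 1)" by (rule sign_cycles_on[OF fA A(2) ab(1)])
      finally show "pminor (p \<circ> (transpose x y \<circ> (a \<circ> b))) A =
          pminor (p \<circ> transpose x y) A * (-1) ^ (card A - 1)" .
    qed
    also have "\<dots> = fact (card A - 1) * fact (card S - card A - 1) *
        (pminor (p \<circ> transpose x y) A * (-1) ^ (card A - 1))"
      using card_cycles_on[OF fA A(2)] card_cycles_on[OF fD] 2 A S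
      by (simp add: case_prod_unfold card_cartesian_product card_Diff_subset fA)
    finally show ?thesis unfolding R by simp
  next
    case (3 x y)
    have xyS: "x \<in> S" "y \<in> S" using 3 A by auto
    let ?t = "transpose x y"
    have tA': "?t ` A = A" and tB: "?t ` B = B" using 3 by simp_all
    have neg: "pminor (p \<circ> (?t \<circ> c \<circ> ?t)) A = - pminor (p \<circ> c) A" for c
    proof (cases "c ` A = B")
      case True
      have "pminor (p \<circ> (?t \<circ> c \<circ> ?t)) A = pminor ((p \<circ> ?t \<circ> c) \<circ> ?t) A"
        by (simp add: o_assoc)
      also have "\<dots> = pminor (p \<circ> ?t \<circ> c) A * sign_on A ?t"
        by (intro pminor_comp fA tA') simp
      also have "sign_on A ?t = -1" using 3 by (intro sign_on_transpose) auto
      \<comment> \<open>The left transposition is invisible here: \<open>c\<close> maps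
        \<open>A\<close> to \<open>B\<close>, which contains neither \<open>x\<close> nor
        \<open>y\<close>.\<close>
      also have "pminor (p \<circ> ?t \<circ> c) A = pminor (p \<circ> c) A"
      proof (rule pminor_cong)
        fix z assume "z \<in> A"
        then have "c z \<noteq> x" "c z \<noteq> y" using True 3 by auto
        then show "(p \<circ> ?t \<circ> c) z = (p \<circ> c) z" by simp
      qed
      finally show ?thesis by (simp only: mult_minus1_right)
    next
      case False
      have "(?t \<circ> c \<circ> ?t) ` A = ?t ` (c ` A)" using tA' by (metis image_comp)
      then have "(?t \<circ> c \<circ> ?t) ` A \<noteq> B"
        using False tB inj_image_eq_iff[OF inj_transpose, of x y "c ` A" B] by metis
      then show ?thesis using False pm0 by simp
    qed
    have "(\<Sum>c\<in>cycles_on S. pminor (p \<circ> c) A) =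
        (\<Sum>c\<in>cycles_on S. pminor (p \<circ> (?t \<circ> c \<circ> ?t)) A)"
      using sum.reindex_bij_betw[OF bij_betw_conj_cycles_on[OF xyS],
          of "\<lambda>c. pminor (p \<circ> c) A"] by simp
    also have "\<dots> = - (\<Sum>c\<in>cycles_on S. pminor (p \<circ> c) A)"
      unfolding neg by (rule sum_negf)
    finally have "(\<Sum>c\<in>cycles_on S. pminor (p \<circ> c) A) = 0" by simp
    moreover have "pminor (p \<circ> transpose u v) A = 0" if "u \<in> A" "v \<in> S - A" for u v
      using tA[OF that] that 3 by (intro pm0) auto
    ultimately show ?thesis by simp
  qed
qed

lemma sum_cycles_ext_trace:
  assumes "finite S" "p permutes S" "0 < r" "r < card S"
  shows "(\<Sum>c\<in>cycles_on S. ext_trace S r (p \<circ> c)) =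
    (-1) ^ (r - 1) * fact (r - 1) * fact (card S - r - 1) * swap_trace S r p"
proof -
  have "(\<Sum>c\<in>cycles_on S. ext_trace S r (p \<circ> c)) =
      (\<Sum>A | A \<subseteq> S \<and> card A = r. \<Sum>c\<in>cycles_on S. pminor (p \<circ> c) A)"
    unfolding ext_trace_def by (rule sum.swap)
  also have "\<dots> = (\<Sum>A | A \<subseteq> S \<and> card A = r.
      (-1) ^ (r - 1) * fact (r - 1) * fact (card S - r - 1) *
      (\<Sum>x\<in>A. \<Sum>y\<in>S - A. pminor (p \<circ> transpose x y) A))"
  proof (intro sum.cong refl)
    fix A assume "A \<in> {A. A \<subseteq> S \<and> card A = r}"
    then have "A \<subseteq> S" "A \<noteq> {}" "A \<noteq> S" "card A = r" using assms by auto
    with sum_cycles_pminor[OF assms(1,2)] show "(\<Sum>c\<in>cycles_on S. pminor (p \<circ> c) A) =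
      (-1) ^ (r - 1) * fact (r - 1) * fact (card S - r - 1) *
      (\<Sum>x\<in>A. \<Sum>y\<in>S - A. pminor (p \<circ> transpose x y) A)" by blast
  qed
  finally show ?thesis by (simp add: swap_trace_def sum_distrib_left)
qed

section \<open>The recursion for \<open>swap_trace\<close>\<close>

lemma swap_trace_altdef:
  assumes "finite S"
  shows "swap_trace S r p = (\<Sum>(A, x, y) |
    A \<subseteq> S \<and> card A = r \<and> x \<in> A \<and> y \<in> S - A \<and> p ` insert y (A - {x}) = A.
    sign_on A (p \<circ> transpose x y))"
proof -
  define F where "F = {A. A \<subseteq> S \<and> card A = r}"
  have fF: "finite F" unfolding F_def using assms by simp
  have fA: "finite A" if "A \<in> F" for A using that assms by (auto simp: F_def intro: finite_subset)
  let ?X = "SIGMA A:F. SIGMA x:A. S - A"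
  have "swap_trace S r p = (\<Sum>A\<in>F. \<Sum>x\<in>A. \<Sum>y\<in>S - A. pminor (p \<circ> transpose x y) A)"
    by (simp add: swap_trace_def F_def)
  also have "\<dots> = (\<Sum>A\<in>F. \<Sum>(x, y)\<in>(SIGMA x:A. S - A). pminor (p \<circ> transpose x y) A)"
    using assms fA by (intro sum.cong refl) (simp add: sum.Sigma)
  also have "\<dots> = (\<Sum>(A, x, y)\<in>?X. pminor (p \<circ> transpose x y) A)"
    using assms fA fF by (subst sum.Sigma) (auto simp: case_prod_unfold)
  also have "\<dots> = (\<Sum>(A, x, y) |
    A \<subseteq> S \<and> card A = r \<and> x \<in> A \<and> y \<in> S - A \<and> p ` insert y (A - {x}) = A.
    pminor (p \<circ> transpose x y) A)"
  proof (rule sum.mono_neutral_right)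
    show "finite ?X" using assms fA fF by (intro finite_SigmaI) auto
    show "\<forall>i\<in>?X - {(A, x, y). A \<subseteq> S \<and> card A = r \<and> x \<in> A \<and> y \<in> S - A \<and> p ` insert y (A - {x}) = A}.
       (case i of (A, x, y) \<Rightarrow> pminor (p \<circ> transpose x y) A) = 0"
    proof
      fix i assume i: "i \<in> ?X - {(A, x, y). A \<subseteq> S \<and> card A = r \<and> x \<in> A \<and> y \<in> S - A \<and>
        p ` insert y (A - {x}) = A}"
      obtain A x y where ixy: "i = (A, x, y)" by (cases i)
      have *: "A \<in> F" "x \<in> A" "y \<in> S" "y \<notin> A" using i by (auto simp: ixy)
      then have "p ` insert y (A - {x}) \<noteq> A" using i by (auto simp: F_def ixy)
      then have "(p \<circ> transpose x y) ` A \<noteq> A"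
        using image_transpose[OF *(2,4)] by (metis image_comp)
      then show "(case i of (A, x, y) \<Rightarrow> pminor (p \<circ> transpose x y) A) = 0"
        by (simp add: pminor_def ixy)
    qed
  qed (auto simp: F_def)
  also have "\<dots> = (\<Sum>(A, x, y) |
    A \<subseteq> S \<and> card A = r \<and> x \<in> A \<and> y \<in> S - A \<and> p ` insert y (A - {x}) = A.
    sign_on A (p \<circ> transpose x y))"
  proof (intro sum.cong refl, clarify)
    fix A x y assume *: "x \<in> A" "y \<in> S" "y \<notin> A" "p ` insert y (A - {x}) = A"
    have "(p \<circ> transpose x y) ` A = A"
      using image_transpose[OF *(1,3)] *(4) by (metis image_comp)
    then show "pminor (p \<circ> transpose x y) A = sign_on A (p \<circ> transpose x y)"
      by (simp add: pminor_def)
  qed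
  finally show ?thesis .
qed

text \<open>On the enlarged set, \<open>p \<circ> transpose (p x) y\<close> is the old restriction
  \<open>q\<close>, which fixes \<open>p x\<close>, composed with \<open>transpose x (p x)\<close>;
  this one transposition accounts for the sign. The case \<open>p x = y\<close>, in which the path
  closes up to a cycle, is included.\<close>

lemma sign_on_extend_swap:
  assumes "finite A" "inj p" "x \<in> A" "y \<notin> A" "p x \<notin> A" "p ` insert y (A - {x}) = A"
  shows "sign_on (insert (p x) A) (p \<circ> transpose (p x) y) = - sign_on A (p \<circ> transpose x y)"
proof -
  define q where "q = restrict_id (p \<circ> transpose x y) A"
  have "(p \<circ> transpose x y) ` A = A"
    using image_transpose[OF assms(3,4)] assms(6) by (metis image_comp)
  then have "bij_betw (p \<circ> transpose x y) A A"
    using assms(2) by (auto simp: bij_betw_def intro!: comp_inj_on intro: inj_on_subset)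
  then have q: "q permutes A" unfolding q_def by (rule permutes_restrict_id)
  let ?A = "insert (p x) A"
  have neq: "x \<noteq> p x" "x \<noteq> y" using assms by auto
  have "sign_on ?A (p \<circ> transpose (p x) y) = sign_on ?A (q \<circ> transpose x (p x))"
  proof (rule sign_on_cong[OF refl])
    fix z assume "z \<in> ?A"
    then consider "z = x" | "z = p x" | "z \<in> A" "z \<noteq> x" "z \<noteq> p x" by blast
    then show "(p \<circ> transpose (p x) y) z = (q \<circ> transpose x (p x)) z"
    proof cases
      case 1 then show ?thesis using neq assms by (simp add: q_def)
    next
      case 2 then show ?thesis using assms by (simp add: q_def)
    next
      case 3
      then have "z \<noteq> y" using assms by auto
      then show ?thesis using 3 by (simp add: q_def)
    qed
  qed
  also have "\<dots> = sign_on ?A q * sign_on ?A (transpose x (p x))"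
  proof (rule sign_on_compose)
    show "bij_betw q ?A ?A" using permutes_imp_bij[OF permutes_imp_permutes_insert[OF q]] .
  qed (use assms in auto)
  also have "sign_on ?A (transpose x (p x)) = -1"
    using assms neq by (intro sign_on_transpose) auto
  also have "sign_on ?A q = sign_on A (p \<circ> transpose x y)"
  proof -
    have "sign_on ?A q = sign q" using q by (intro sign_on_permutes) auto
    then show ?thesis unfolding q_def sign_on_def .
  qed
  finally show ?thesis by (simp only: mult_minus1_right)
qed

text \<open>The transposition makes \<open>p y\<close> a fixed point, so adding it to
  \<open>B\<close> does not change the restriction. This treats the paths with the single step from
  \<open>y\<close> to \<open>p y\<close>.\<close>

lemma sign_on_insert_fixed:
  assumes "p y \<notin> B" "y \<notin> B"
  shows "sign_on (insert (p y) B) (p \<circ> transpose (p y) y) = sign_on B p"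
proof -
  have "restrict_id (p \<circ> transpose (p y) y) (insert (p y) B) = restrict_id p B"
  proof
    fix z
    consider "z = p y" | "z \<in> B" "z \<noteq> p y" "z \<noteq> y" | "z \<notin> insert (p y) B" using assms by blast
    then show "restrict_id (p \<circ> transpose (p y) y) (insert (p y) B) z = restrict_id p B z"
      by cases (use assms in auto)
  qed
  then show ?thesis by (simp only: sign_on_def)
qed

text \<open>
  This is the anticommutation relation between exterior multiplication and contraction.
  A triple \<open>(A, x, y)\<close> that contributes to \<open>swap_trace\<close> contains a \<open>p\<close>-path from \<open>y\<close> to \<open>x\<close>; prolonging
  the path by one step, \<open>(A, x, y) \<mapsto> (insert (p x) A, p x, y)\<close>, reverses the sign.
\<close>

lemma swap_trace_Suc:
  assumes S: "finite S" and p: "p permutes S"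
  shows "swap_trace S (Suc r) p + int (Suc r) * ext_trace S (Suc r) p =
    (int (card S) - int r) * ext_trace S r p - swap_trace S r p"
proof -
  note inj = permutes_inj[OF p] and pS = permutes_in_image[OF p] and pinv = permutes_inverses[OF p]
  define W where "W r = {(A, x, y). A \<subseteq> S \<and> card A = r \<and> x \<in> A \<and> y \<in> S - A \<and>
    p ` insert y (A - {x}) = A}" for r
  define V where "V = {(A, x). A \<subseteq> S \<and> card A = Suc r \<and> x \<in> A \<and> p ` A = A}"
  define U where "U = {(B, y). B \<subseteq> S \<and> card B = r \<and> y \<in> S - B \<and> p ` B = B}"
  \<comment> \<open>Allowing \<open>y = x\<close> adds to the triples of \<open>swap_trace\<close>
    the invariant sets with a marked element, collected in \<open>V\<close>. These are closed paths,
    and they give the term with \<open>ext_trace\<close> of degree \<open>Suc r\<close>.\<close>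
  define J where "J = {(A, x, y). A \<subseteq> S \<and> card A = Suc r \<and> x \<in> A \<and> y \<in> S \<and> y \<notin> A - {x} \<and>
    p ` insert y (A - {x}) = A}"
  \<comment> \<open>\<open>J1\<close> has the paths whose last step can be removed,
    \<open>J2\<close> those with the single step from \<open>y\<close> to \<open>p y = x\<close>. In
    the latter, removing \<open>x\<close> from \<open>A\<close> leaves an invariant set that avoids
    \<open>y\<close>, which is an element of \<open>U\<close>.\<close>
  define J1 where "J1 = {(A, x, y) \<in> J. p y \<noteq> x}"
  define J2 where "J2 = {(A, x, y) \<in> J. p y = x}"
  define f where "f = (\<lambda>(A, x, y). sign_on A (p \<circ> transpose x y))"
  have "finite (Pow S \<times> S \<times> S)" using S by simp
  then have finJ: "finite J" by (rule finite_subset[rotated]) (auto simp: J_def)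
  have fin: "finite A" if "A \<subseteq> S" for A using that S by (rule finite_subset)
  have W: "swap_trace S r p = sum f (W r)" for r
    unfolding swap_trace_altdef[OF S] W_def f_def ..
  have V: "int (Suc r) * ext_trace S (Suc r) p = (\<Sum>(A, x)\<in>V. sign_on A p)"
  proof -
    have "V = (SIGMA A:{A. A \<subseteq> S \<and> card A = Suc r \<and> p ` A = A}. A)" by (auto simp: V_def)
    then have "(\<Sum>(A, x)\<in>V. sign_on A p) =
        (\<Sum>A | A \<subseteq> S \<and> card A = Suc r \<and> p ` A = A. \<Sum>x\<in>A. sign_on A p)"
      by (subst sum.Sigma) (use S fin in auto)
    also have "\<dots> = (\<Sum>A | A \<subseteq> S \<and> card A = Suc r \<and> p ` A = A. int (Suc r) * pminor p A)"
      by (intro sum.cong) (auto simp: pminor_def)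
    also have "\<dots> = (\<Sum>A | A \<subseteq> S \<and> card A = Suc r. int (Suc r) * pminor p A)"
      using S by (intro sum.mono_neutral_left) (auto simp: pminor_def)
    finally show ?thesis by (simp add: ext_trace_def sum_distrib_left)
  qed
  have U: "(int (card S) - int r) * ext_trace S r p = (\<Sum>(B, y)\<in>U. sign_on B p)"
  proof -
    have "U = (SIGMA B:{B. B \<subseteq> S \<and> card B = r \<and> p ` B = B}. S - B)" by (auto simp: U_def)
    then have "(\<Sum>(B, y)\<in>U. sign_on B p) =
        (\<Sum>B | B \<subseteq> S \<and> card B = r \<and> p ` B = B. \<Sum>y\<in>S - B. sign_on B p)"
      by (subst sum.Sigma) (use S fin in auto)
    also have "\<dots> = (\<Sum>B | B \<subseteq> S \<and> card B = r \<and> p ` B = B. (int (card S) - int r) * pminor p B)"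
      using fin S by (intro sum.cong) (auto simp: pminor_def card_Diff_subset of_nat_diff card_mono)
    also have "\<dots> = (\<Sum>B | B \<subseteq> S \<and> card B = r. (int (card S) - int r) * pminor p B)"
      using S by (intro sum.mono_neutral_left) (auto simp: pminor_def)
    finally show ?thesis by (simp add: ext_trace_def sum_distrib_left)
  qed
  have "sum f J = sum f (W (Suc r)) + sum f ((\<lambda>(A, x). (A, x, x)) ` V)"
  proof -
    have "(A, x, y) \<in> J \<longleftrightarrow> (A, x, y) \<in> W (Suc r) \<or> (y = x \<and> (A, x) \<in> V)" for A x y
    proof (cases "x \<in> A \<and> y = x")
      case True
      then have "insert y (A - {x}) = A" by auto
      then show ?thesis using True by (auto simp: J_def W_def V_def simp del: image_insert)
    next
      case False
      then show ?thesis by (auto simp: J_def W_def V_def simp del: image_insert)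
    qed
    moreover have "(A, x, y) \<in> (\<lambda>(A, x). (A, x, x)) ` V \<longleftrightarrow> y = x \<and> (A, x) \<in> V" for A x y
      by auto
    ultimately have "j \<in> J \<longleftrightarrow> j \<in> W (Suc r) \<union> (\<lambda>(A, x). (A, x, x)) ` V" for j
      by (cases j) (simp only: Un_iff)
    then have "J = W (Suc r) \<union> (\<lambda>(A, x). (A, x, x)) ` V" by (rule set_eqI)
    moreover have "W (Suc r) \<inter> (\<lambda>(A, x). (A, x, x)) ` V = {}" by (auto simp: W_def V_def)
    ultimately show ?thesis using finJ by (simp add: sum.union_disjoint)
  qed
  also have "sum f ((\<lambda>(A, x). (A, x, x)) ` V) = (\<Sum>(A, x)\<in>V. sign_on A p)"
    by (subst sum.reindex) (auto simp: inj_on_def f_def intro!: sum.cong)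
  finally have J: "sum f J = swap_trace S (Suc r) p + int (Suc r) * ext_trace S (Suc r) p"
    by (simp only: V W)
  have "sum f J1 = (\<Sum>w\<in>W r. - f w)"
  proof (rule sum.reindex_bij_witness[where
        i = "\<lambda>(A, x, y). (insert (p x) A, p x, y)" and j = "\<lambda>(A, x, y). (A - {x}, inv p x, y)"])
    fix a assume "a \<in> J1"
    then obtain A x y where a: "a = (A, x, y)" and A: "A \<subseteq> S" "card A = Suc r" "x \<in> A" "y \<in> S"
      "y \<notin> A - {x}" "p ` insert y (A - {x}) = A" "p y \<noteq> x"
      by (auto simp: J1_def J_def)
    \<comment> \<open>As \<open>p y \<noteq> x\<close>, the preimage \<open>u\<close> of
      \<open>x\<close> lies in \<open>A - {x}\<close>; it is the end of the shortened path.\<close>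
    have "x \<in> p ` insert y (A - {x})" using A(3,6) by simp
    then obtain u where u: "u \<in> A - {x}" "p u = x" using A(7) by blast
    have iu: "inv p x = u" using u(2) pinv by auto
    have "insert y (A - {x} - {u}) = insert y (A - {x}) - {u}" using A u by auto
    then have "p ` insert y (A - {x} - {u}) = A - {x}"
      using A(6) u(2) inj by (simp only: image_set_diff image_insert image_empty)
    then have Wr: "(A - {x}, u, y) \<in> W r" using A u fin by (auto simp: W_def)
    then show "(case a of (A, x, y) \<Rightarrow> (A - {x}, inv p x, y)) \<in> W r" by (simp add: a iu)
    show "(case case a of (A, x, y) \<Rightarrow> (A - {x}, inv p x, y) of
        (A, x, y) \<Rightarrow> (insert (p x) A, p x, y)) = a"
      using A(3) pinv by (simp add: a insert_absorb)
    have "f a = - f (A - {x}, u, y)"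
      using sign_on_extend_swap[of "A - {x}" p u y] Wr fin[OF A(1)] inj u(2) A(3)
      by (simp add: f_def a W_def insert_absorb)
    then show "- f (case a of (A, x, y) \<Rightarrow> (A - {x}, inv p x, y)) = f a" by (simp add: a iu)
  next
    fix b assume "b \<in> W r"
    then obtain A x y where b: "b = (A, x, y)" and A: "A \<subseteq> S" "card A = r" "x \<in> A" "y \<in> S"
      "y \<notin> A" "p ` insert y (A - {x}) = A"
      by (auto simp: W_def)
    have "p x \<notin> p ` insert y (A - {x})" using A inj by (auto dest: injD)
    then have px: "p x \<notin> A" by (simp only: A(6) not_False_eq_True)
    show "(case case b of (A, x, y) \<Rightarrow> (insert (p x) A, p x, y) of
        (A, x, y) \<Rightarrow> (A - {x}, inv p x, y)) = b"
      using px pinv by (simp add: b)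
    have "p ` insert y A = insert (p x) A"
    proof -
      have "insert y A = insert x (insert y (A - {x}))" using A by auto
      then show ?thesis using A(6) by (metis image_insert)
    qed
    moreover have "p y \<noteq> p x" using A inj by (auto dest: injD)
    ultimately show "(case b of (A, x, y) \<Rightarrow> (insert (p x) A, p x, y)) \<in> J1"
      using A px pS fin by (simp add: b J1_def J_def) blast
  qed
  also have "\<dots> = - swap_trace S r p" unfolding W by (rule sum_negf)
  finally have J1: "sum f J1 = - swap_trace S r p" .
  have J2: "sum f J2 = (\<Sum>(B, y)\<in>U. sign_on B p)"
  proof (rule sum.reindex_bij_witness[where
        i = "\<lambda>(B, y). (insert (p y) B, p y, y)" and j = "\<lambda>(A, x, y). (A - {x}, y)"])
    fix a assume "a \<in> J2"
    then obtain A x y where a: "a = (A, x, y)" and A: "A \<subseteq> S" "card A = Suc r" "x \<in> A" "y \<in> S"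
      "y \<notin> A - {x}" "p ` insert y (A - {x}) = A" "p y = x"
      by (auto simp: J2_def J_def)
    have eq: "insert y (A - {x}) - {y} = A - {x}" using A(5) by auto
    have "p ` (insert y (A - {x}) - {y}) = A - {x}"
      using A(6,7) inj by (simp only: image_set_diff image_insert image_empty)
    then have "p ` (A - {x}) = A - {x}" by (simp only: eq)
    then show "(case a of (A, x, y) \<Rightarrow> (A - {x}, y)) \<in> U"
      using A fin by (auto simp: a U_def)
    show "(case case a of (A, x, y) \<Rightarrow> (A - {x}, y) of (B, y) \<Rightarrow> (insert (p y) B, p y, y)) = a"
      using A by (auto simp: a)
    show "(case case a of (A, x, y) \<Rightarrow> (A - {x}, y) of (B, y) \<Rightarrow> sign_on B p) = f a"
      using sign_on_insert_fixed[of p y "A - {x}"] A by (simp add: a f_def insert_absorb)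
  next
    fix b assume "b \<in> U"
    then obtain B y where b: "b = (B, y)" and B: "B \<subseteq> S" "card B = r" "y \<in> S" "y \<notin> B" "p ` B = B"
      by (auto simp: U_def)
    have "p y \<notin> p ` B" using B(4) inj by (auto dest: injD)
    then have py: "p y \<notin> B" by (simp only: B(5) not_False_eq_True)
    then show "(case case b of (B, y) \<Rightarrow> (insert (p y) B, p y, y) of (A, x, y) \<Rightarrow> (A - {x}, y)) = b"
      by (simp add: b)
    show "(case b of (B, y) \<Rightarrow> (insert (p y) B, p y, y)) \<in> J2"
      using B py pS fin by (simp add: b J2_def J_def)
  qed
  have "J = J1 \<union> J2" "J1 \<inter> J2 = {}" by (auto simp: J1_def J2_def)
  then have "sum f J = sum f J1 + sum f J2"
    using finJ by (simp add: sum.union_disjoint)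
  with J J1 J2 U show ?thesis by simp
qed

text \<open>
  The character of the hook \<open>(n - r, 1\<^sup>r)\<close>: the \<open>r\<close>-th exterior power of the permutation
  representation is the sum of those of the standard representation of degrees \<open>r\<close> and \<open>r - 1\<close>.
\<close>

primrec hook_char :: "'a set \<Rightarrow> nat \<Rightarrow> ('a \<Rightarrow> 'a) \<Rightarrow> int" where
  "hook_char S 0 p = ext_trace S 0 p"
| "hook_char S (Suc r) p = ext_trace S (Suc r) p - hook_char S r p"

lemma swap_trace_0: "finite S \<Longrightarrow> swap_trace S 0 p = 0"
proof -
  assume "finite S"
  then have "A = {}" if "A \<subseteq> S" "card A = 0" for A using that by (auto dest: finite_subset)
  then have "{A. A \<subseteq> S \<and> card A = 0} = {{}}" by auto
  then show ?thesis unfolding swap_trace_def by simp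
qed

text \<open>For \<open>X r = swap_trace S r p + r * ext_trace S r p\<close> and
  \<open>n = card S\<close>, the preceding recursion reads
  \<open>X (Suc r) = n * ext_trace S r p - X r\<close>. Up to the factor \<open>n\<close> and a
  shift of the index, this is the recursion that defines \<open>hook_char\<close>.\<close>

lemma swap_trace_eq_hook_char:
  assumes "finite S" "p permutes S"
  shows "swap_trace S (Suc r) p = int (card S) * hook_char S r p - int (Suc r) * ext_trace S (Suc r) p"
proof (induction r)
  case 0
  then show ?case using swap_trace_Suc[OF assms, of 0] swap_trace_0[OF assms(1), of p] by simp
next
  case (Suc r)
  then show ?case using swap_trace_Suc[OF assms, of "Suc r"] by (simp add: algebra_simps)
qed

lemma ext_trace_0: "finite S \<Longrightarrow> ext_trace S 0 p = 1"
proof -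
  assume "finite S"
  then have "{A. A \<subseteq> S \<and> card A = 0} = {{}}" by (auto dest: finite_subset)
  moreover have "sign_on {} p = 1" using sign_on_cong[of "{}" "{}" p id] by simp
  ultimately show ?thesis by (simp add: ext_trace_def pminor_def)
qed

text \<open>Writing \<open>swap_trace\<close> through the hook characters of degrees
  \<open>r\<close> and \<open>Suc r\<close> produces a multiple of \<open>hook_char S r p\<close>
  that exactly cancels the contribution of the induction hypothesis. Division by
  \<open>fact (card S - 1)\<close> turns the remaining constant into the eigenvalue.\<close>

lemma sum_cycles_hook_char:
  assumes "finite S" "p permutes S" "r < card S"
  shows "(\<Sum>c\<in>cycles_on S. hook_char S r (p \<circ> c)) =
    (-1) ^ r * fact r * fact (card S - 1 - r) * hook_char S r p"
  using assms(3)
proof (induction r)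
  case 0
  then have "S \<noteq> {}" by auto
  then show ?case using card_cycles_on[OF assms(1)] by (simp add: ext_trace_0[OF assms(1)])
next
  case (Suc r)
  define d where "d = card S - r - 2"
  have d: "card S = d + r + 2" using Suc.prems by (simp add: d_def)
  have ar: "card S - 1 - r = Suc d" "card S - Suc r - 1 = d" by (simp_all add: d)
  note IH = Suc.IH[OF Suc_lessD[OF Suc.prems], unfolded ar]
  note E = sum_cycles_ext_trace[OF assms(1,2) zero_less_Suc Suc.prems, unfolded ar diff_Suc_1]
  have "(\<Sum>c\<in>cycles_on S. hook_char S (Suc r) (p \<circ> c)) =
      (\<Sum>c\<in>cycles_on S. ext_trace S (Suc r) (p \<circ> c)) - (\<Sum>c\<in>cycles_on S. hook_char S r (p \<circ> c))"
    by (simp add: sum_subtractf)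
  also have "\<dots> = (-1) ^ r * fact r * fact d * swap_trace S (Suc r) p -
      (-1) ^ r * fact r * fact (Suc d) * hook_char S r p"
    by (simp only: IH E)
  also have "swap_trace S (Suc r) p = (d + 1) * hook_char S r p - (r + 1) * hook_char S (Suc r) p"
    unfolding swap_trace_eq_hook_char[OF assms(1,2)] d by (simp add: algebra_simps)
  also have "(-1) ^ r * fact r * fact d * ((d + 1) * hook_char S r p - (r + 1) * hook_char S (Suc r) p) -
      (-1) ^ r * fact r * fact (Suc d) * hook_char S r p =
      (-1) ^ Suc r * fact (Suc r) * fact d * hook_char S (Suc r) p"
    by (simp add: algebra_simps)
  finally show ?case using d by simp
qed

subsection \<open>Long cycles in terms of hook characters\<close>

lemma sum_partial_sums:
  fixes g :: "nat \<Rightarrow> int"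
  shows "(\<Sum>r<n. \<Sum>i\<le>r. g i) = (\<Sum>i\<le>n. (int n - int i) * g i)"
proof (induction n)
  case (Suc n)
  have "(\<Sum>i\<le>Suc n. (int (Suc n) - int i) * g i) = (\<Sum>i\<le>n. (int n - int i) * g i + g i)"
    by (simp add: algebra_simps)
  then show ?case using Suc by (simp add: sum.distrib)
qed simp

lemma hook_char_eq_sum: "(-1) ^ r * hook_char S r p = (\<Sum>i\<le>r. (-1) ^ i * ext_trace S i p)"
  by (induction r) (simp_all add: algebra_simps)

lemma restrict_id_cycles_on:
  assumes "cyclic_on p C" "inj p" "p ` C = C"
  shows "restrict_id p C \<in> cycles_on C"
proof -
  have "restrict_id p C permutes C"
    using assms by (intro permutes_restrict_id) (auto simp: bij_betw_def intro: inj_on_subset)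
  moreover have "cyclic_on (restrict_id p C) C"
    using assms(1) cyclic_cong[of C p "restrict_id p C"] by simp
  ultimately show ?thesis by (simp add: cycles_on_def)
qed

lemma sign_on_Un:
  assumes "finite A" "finite B" "A \<inter> B = {}" "inj p" "p ` A = A" "p ` B = B"
  shows "sign_on (A \<union> B) p = sign_on A p * sign_on B p"
proof -
  have bij: "bij_betw p A A" "bij_betw p B B"
    using assms(4-6) by (auto simp: bij_betw_def intro: inj_on_subset)
  have "restrict_id p (A \<union> B) x = (restrict_id p A \<circ> restrict_id p B) x" for x
    using assms(3,6) unfolding restrict_id_def by auto
  then have "restrict_id p (A \<union> B) = restrict_id p A \<circ> restrict_id p B" by auto
  moreover have "permutation (restrict_id p A)" "permutation (restrict_id p B)"
    using assms(1,2) permutes_restrict_id bij permutes_imp_permutation by blast+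
  ultimately show ?thesis unfolding sign_on_def by (simp add: sign_compose)
qed

text \<open>An orbit of size \<open>m\<close> has sign \<open>(-1) ^ (m - 1)\<close> and changes the
  prefactor by \<open>(-1) ^ m\<close>, so each orbit contributes the factor -1 whatever its
  size.\<close>

lemma pminor_Un_orbit:
  assumes "finite A" "permutation p" "p ` A = A" "x \<notin> A"
  shows "orbit p x \<inter> A = {}"
    and "(-1) ^ card (A \<union> orbit p x) * pminor p (A \<union> orbit p x) = - ((-1) ^ card A * pminor p A)"
proof -
  let ?C = "orbit p x"
  have inj: "inj p" using assms(2) permutation_bijective bij_is_inj by blast
  have C: "p ` ?C = ?C" "cyclic_on p ?C" "finite ?C"
    using image_orbit[OF assms(2)] cyclic_on_orbit'[OF assms(2)]
      finite_orbit[OF permutation_self_in_orbit[OF assms(2)]] by simp_all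
  show disj: "?C \<inter> A = {}"
  proof (rule ccontr)
    assume "?C \<inter> A \<noteq> {}"
    then obtain u where u: "u \<in> ?C" "u \<in> A" by auto
    then have "x \<in> orbit p u" using orbit_swap permutation_self_in_orbit[OF assms(2)] by metis
    then show False using orbit_subset_invariant[of p A u] u assms by auto
  qed
  have "sign_on ?C p = (-1) ^ (card ?C - 1)"
    unfolding sign_on_def
    by (rule sign_cycles_on[OF C(3) orbit_nonempty restrict_id_cycles_on[OF C(2) inj C(1)]])
  then have "sign_on (A \<union> ?C) p = sign_on A p * (-1) ^ (card ?C - 1)"
    using sign_on_Un[of A ?C p] assms C inj disj by auto
  moreover have "p ` (A \<union> ?C) = A \<union> ?C" using assms C by (simp add: image_Un)
  moreover have "card (A \<union> ?C) = card A + card ?C"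
    using assms C disj by (intro card_Un_disjoint) auto
  moreover obtain m where "card ?C = Suc m"
    using C(3) orbit_nonempty[of p x] by (metis card_eq_0_iff not0_implies_Suc)
  ultimately show "(-1) ^ card (A \<union> ?C) * pminor p (A \<union> ?C) = - ((-1) ^ card A * pminor p A)"
    using assms(3) by (simp add: pminor_def power_add)
qed

text \<open>
  If \<open>p\<close> is not a long cycle, there is an orbit that avoids \<open>z\<close>, and adding it to or removing it
  from \<open>A\<close> reverses the sign.
\<close>

lemma sum_pminor_avoiding:
  assumes S: "finite S" and p: "p permutes S" and z: "z \<in> S"
  shows "(\<Sum>A | A \<subseteq> S - {z}. (-1) ^ card A * pminor p A) = of_bool (p \<in> cycles_on S)"
proof -
  define w where "w A = (-1) ^ card A * pminor p A" for A
  define X where "X = {A. A \<subseteq> S - {z} \<and> p ` A = A}"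
  have perm: "permutation p" using S p permutes_imp_permutation by blast
  have X: "(\<Sum>A | A \<subseteq> S - {z}. w A) = sum w X"
    using S by (intro sum.mono_neutral_right) (auto simp: X_def w_def pminor_def)
  have "sum w X = of_bool (p \<in> cycles_on S)"
  proof (cases "p \<in> cycles_on S")
    case True
    then have "X = {{}}"
      using cyclic_on_iff_invariant[OF S permutes_imp_bij[OF p]] z
      by (auto simp: X_def cycles_on_def)
    moreover have "w {} = 1"
      using sign_on_cong[of "{}" "{}" p id] by (simp add: w_def pminor_def)
    ultimately show ?thesis using True by simp
  next
    case False
    have "orbit p z \<noteq> S" using False p cyclic_on_orbit'[OF perm, of z] by (auto simp: cycles_on_def)
    then obtain x where x: "x \<in> S" "x \<notin> orbit p z" using permutes_orbit_subset[OF p z] by blast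
    let ?C = "orbit p x"
    have zC: "z \<notin> ?C" using x orbit_swap permutation_self_in_orbit[OF perm] by metis
    have C: "?C \<subseteq> S" "p ` ?C = ?C" "x \<in> ?C"
      using permutes_orbit_subset[OF p x(1)] image_orbit[OF perm] permutation_self_in_orbit[OF perm]
      by auto
    have fin: "finite A" if "A \<in> X" for A using that S by (auto simp: X_def intro: finite_subset)
    have disj: "?C \<inter> A = {}" and neg: "w (A \<union> ?C) = - w A" if "A \<in> X" "x \<notin> A" for A
      using pminor_Un_orbit[OF fin[OF that(1)] perm _ that(2)] that by (auto simp: X_def w_def)
    have sub: "?C \<subseteq> A" if "A \<in> X" "x \<in> A" for A
      using that orbit_subset_invariant[of p A x] by (auto simp: X_def)
    have un: "A \<union> ?C \<in> X" if "A \<in> X" for A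
      using that C zC by (auto simp: X_def image_Un)
    have df: "A - ?C \<in> X" if "A \<in> X" for A
      using that C(2) image_set_diff[OF permutes_inj[OF p], of A ?C] by (auto simp: X_def)
    let ?f = "\<lambda>A. if x \<in> A then A - ?C else A \<union> ?C"
    have "sum w X = (\<Sum>A\<in>X. - w A)"
    proof (rule sum.reindex_bij_witness[where i = ?f and j = ?f])
      fix A assume A: "A \<in> X"
      show "?f A \<in> X" using un[OF A] df[OF A] by simp
      show "?f (?f A) = A" using disj[OF A] sub[OF A] C(3) by auto
      show "- w (?f A) = w A"
      proof (cases "x \<in> A")
        case True
        then have "A - ?C \<union> ?C = A" using sub[OF A] by blast
        then show ?thesis using neg[OF df[OF A]] C(3) True by simp
      next
        case False
        then show ?thesis using neg[OF A] by simp
      qed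
    next
      fix A assume A: "A \<in> X"
      show "?f A \<in> X" using un[OF A] df[OF A] by simp
      show "?f (?f A) = A" using disj[OF A] sub[OF A] C(3) by auto
    qed
    then have "sum w X = - sum w X" by (simp add: sum_negf)
    then show ?thesis using False by simp
  qed
  then show ?thesis using X unfolding w_def by metis
qed

text \<open>In the double alternating sum, the minor of \<open>A\<close> occurs
  \<open>card S - card A\<close> times. This number counts the points \<open>z\<close> of
  \<open>S - A\<close>, and for fixed \<open>z\<close> the sum over \<open>A\<close> is the
  preceding one.\<close>

lemma sum_alternating_hook_char:
  assumes S: "finite S" and p: "p permutes S"
  shows "(\<Sum>r<card S. (-1) ^ r * hook_char S r p) = int (card S) * of_bool (p \<in> cycles_on S)"
proof -
  define w where "w A = (-1) ^ card A * pminor p A" for A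
  have fin: "finite A" if "A \<subseteq> S" for A using that S by (rule finite_subset)
  have "(\<Sum>r<card S. (-1) ^ r * hook_char S r p) =
      (\<Sum>i\<le>card S. (int (card S) - int i) * ((-1) ^ i * ext_trace S i p))"
    unfolding hook_char_eq_sum by (rule sum_partial_sums)
  also have "\<dots> = (\<Sum>i\<le>card S. \<Sum>A | A \<in> Pow S \<and> card A = i. int (card (S - A)) * w A)"
  proof (intro sum.cong refl)
    fix i
    show "(int (card S) - int i) * ((-1) ^ i * ext_trace S i p) =
        (\<Sum>A | A \<in> Pow S \<and> card A = i. int (card (S - A)) * w A)"
      unfolding ext_trace_def sum_distrib_left
      by (intro sum.cong)
        (auto simp: w_def card_Diff_subset fin of_nat_diff card_mono[OF S])
  qed
  also have "\<dots> = (\<Sum>A\<in>Pow S. int (card (S - A)) * w A)"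
    using S by (intro sum.group) (auto intro: card_mono)
  also have "\<dots> = (\<Sum>A\<in>Pow S. \<Sum>z\<in>S. if z \<in> S - A then w A else 0)"
    using S by (intro sum.cong refl) (simp add: sum.If_cases Int_def, simp add: set_diff_eq)
  also have "\<dots> = (\<Sum>z\<in>S. \<Sum>A\<in>Pow S. if z \<in> S - A then w A else 0)"
    by (rule sum.swap)
  also have "\<dots> = (\<Sum>z\<in>S. \<Sum>A | A \<subseteq> S - {z}. w A)"
    using S by (intro sum.cong refl sum.mono_neutral_cong_right) auto
  also have "\<dots> = (\<Sum>z\<in>S. of_bool (p \<in> cycles_on S))"
    unfolding w_def using sum_pminor_avoiding[OF S p] by (intro sum.cong) auto
  finally show ?thesis by simp
qed

subsection \<open>Permutations with a given set in one cycle\<close>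

text \<open>As \<open>q\<close> fixes \<open>a\<close>, composing with \<open>transpose a b\<close>
  only inserts \<open>a\<close> into the cycle of \<open>b\<close>. Since
  \<open>a \<notin> L\<close>, this does not affect which points of \<open>L\<close> share a
  cycle.\<close>

lemma in_same_cycle_insert:
  assumes F: "finite F" "a \<notin> F" and L: "L \<subseteq> F" "L \<noteq> {}" and q: "q permutes F"
    and b: "b \<in> insert a F"
  shows "in_same_cycle (transpose a b \<circ> q) L \<longleftrightarrow> in_same_cycle q L"
proof (cases "b = a")
  case True
  then show ?thesis by simp
next
  case False
  let ?t = "transpose a b"
  have q_perm: "permutation q" using F q permutes_imp_permutation by blast
  then have t_perm: "permutation (?t \<circ> q)"
    by (intro permutation_compose permutation_swap_id)
  have qa: "q a = a" using permutes_not_in[OF q F(2)] .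
  have inj: "inj q" using permutes_inj[OF q] .
  show ?thesis
    unfolding in_same_cycle_iff_invariant[OF q_perm L(2)] in_same_cycle_iff_invariant[OF t_perm L(2)]
  proof (intro iffI allI impI)
    fix T assume *: "\<forall>T. (?t \<circ> q) ` T = T \<longrightarrow> T \<inter> L \<noteq> {} \<longrightarrow> L \<subseteq> T" and T: "q ` T = T" "T \<inter> L \<noteq> {}"
    \<comment> \<open>\<open>T'\<close> is still invariant under \<open>q\<close> because
      \<open>a\<close> is a fixed point, and it is adjusted to contain both or neither of
      \<open>a\<close> and \<open>b\<close>.\<close>
    define T' where "T' = (if b \<in> T then insert a T else T - {a})"
    have "q ` T' = T'"
      using T(1) qa inj by (simp add: T'_def image_set_diff)
    moreover have "?t ` T' = T'" using False by (intro transpose_image_eq) (auto simp: T'_def)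
    ultimately have "(?t \<circ> q) ` T' = T'" by (metis image_comp)
    moreover have "T' \<inter> L = T \<inter> L" using L F by (auto simp: T'_def)
    ultimately show "L \<subseteq> T" using * T(2) by blast
  next
    fix T assume *: "\<forall>T. q ` T = T \<longrightarrow> T \<inter> L \<noteq> {} \<longrightarrow> L \<subseteq> T" and T: "(?t \<circ> q) ` T = T" "T \<inter> L \<noteq> {}"
    have inj_t: "inj (?t \<circ> q)" using inj by (intro inj_compose) auto
    have "a \<in> T \<longleftrightarrow> b \<in> T"
    proof -
      have "(?t \<circ> q) a = b" using qa by simp
      then show ?thesis using inj_image_mem_iff[OF inj_t, of a T] T(1) by metis
    qed
    then have "?t ` T = T" by simp
    moreover have "?t ` (q ` T) = T" using T(1) by (metis image_comp)
    ultimately have "q ` T = T" using inj_image_eq_iff[OF inj_transpose, of a b "q ` T" T] by metis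
    then show "L \<subseteq> T" using * T(2) by blast
  qed
qed

lemma in_same_cycle_comp:
  assumes S: "finite S" and A: "A \<subseteq> S" and L: "L \<subseteq> S" "L \<noteq> {}"
    and f: "f permutes A" and g: "g permutes (S - A)"
  shows "in_same_cycle (f \<circ> g) L \<longleftrightarrow>
    L \<subseteq> A \<and> in_same_cycle f L \<or> L \<subseteq> S - A \<and> in_same_cycle g L"
proof -
  have fin: "finite A" "finite (S - A)" using S A by (auto intro: finite_subset)
  have perm: "permutation f" "permutation g" "permutation (f \<circ> g)"
    using f g fin permutes_imp_permutation permutation_compose by blast+
  note inv = in_same_cycle_iff_invariant[OF perm(1) L(2)] in_same_cycle_iff_invariant[OF perm(2) L(2)]
    in_same_cycle_iff_invariant[OF perm(3) L(2)]
  have fx: "f x = x" if "x \<notin> A" for x using permutes_not_in[OF f that] .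
  have gx: "g x = x" if "x \<in> A \<or> x \<notin> S" for x using permutes_not_in[OF g] that by auto
  have gA: "g ` T = T" if "T \<subseteq> A" for T using that gx by force
  have fB: "f ` T = T" if "T \<subseteq> S - A" for T using that fx by force
  have comp: "(f \<circ> g) ` T = f ` (g ` T)" for T by (simp add: image_comp)
  have inj: "inj f" "inj g" "inj (f \<circ> g)"
    using permutes_inj[OF f] permutes_inj[OF g] by (auto intro: inj_compose)
  have invA: "(f \<circ> g) ` A = A"
    using gA[OF order_refl] permutes_image[OF f] by (simp only: comp)
  have invB: "(f \<circ> g) ` (S - A) = S - A"
    using fB[OF order_refl] permutes_image[OF g] by (simp only: comp)
  have eqA: "in_same_cycle (f \<circ> g) L \<longleftrightarrow> in_same_cycle f L" if LA: "L \<subseteq> A"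
  proof -
    have "(\<forall>T. (f \<circ> g) ` T = T \<longrightarrow> T \<inter> L \<noteq> {} \<longrightarrow> L \<subseteq> T) \<longleftrightarrow>
        (\<forall>T. f ` T = T \<longrightarrow> T \<inter> L \<noteq> {} \<longrightarrow> L \<subseteq> T)"
    proof (intro iffI allI impI)
      fix T assume *: "\<forall>T. (f \<circ> g) ` T = T \<longrightarrow> T \<inter> L \<noteq> {} \<longrightarrow> L \<subseteq> T" and T: "f ` T = T" "T \<inter> L \<noteq> {}"
      have "f ` (T \<inter> A) = T \<inter> A" using T permutes_image[OF f] inj by (simp add: image_Int)
      then have "(f \<circ> g) ` (T \<inter> A) = T \<inter> A" using gA[OF Int_lower2, of T] by (simp only: comp)
      then show "L \<subseteq> T" using *[rule_format, of "T \<inter> A"] T LA by blast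
    next
      fix T assume *: "\<forall>T. f ` T = T \<longrightarrow> T \<inter> L \<noteq> {} \<longrightarrow> L \<subseteq> T" and T: "(f \<circ> g) ` T = T" "T \<inter> L \<noteq> {}"
      have "(f \<circ> g) ` (T \<inter> A) = T \<inter> A" using T invA inj by (simp only: image_Int)
      then have "f ` (T \<inter> A) = T \<inter> A" using gA[OF Int_lower2, of T] by (simp only: comp)
      then show "L \<subseteq> T" using *[rule_format, of "T \<inter> A"] T LA by blast
    qed
    then show ?thesis using inv by simp
  qed
  have eqB: "in_same_cycle (f \<circ> g) L \<longleftrightarrow> in_same_cycle g L" if LB: "L \<subseteq> S - A"
  proof -
    have "(\<forall>T. (f \<circ> g) ` T = T \<longrightarrow> T \<inter> L \<noteq> {} \<longrightarrow> L \<subseteq> T) \<longleftrightarrow>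
        (\<forall>T. g ` T = T \<longrightarrow> T \<inter> L \<noteq> {} \<longrightarrow> L \<subseteq> T)"
    proof (intro iffI allI impI)
      fix T assume *: "\<forall>T. (f \<circ> g) ` T = T \<longrightarrow> T \<inter> L \<noteq> {} \<longrightarrow> L \<subseteq> T" and T: "g ` T = T" "T \<inter> L \<noteq> {}"
      have "g ` (T \<inter> (S - A)) = T \<inter> (S - A)"
        using T permutes_image[OF g] inj by (simp only: image_Int)
      then have "(f \<circ> g) ` (T \<inter> (S - A)) = T \<inter> (S - A)"
        using fB[OF Int_lower2, of T] by (simp only: comp)
      then show "L \<subseteq> T" using *[rule_format, of "T \<inter> (S - A)"] T LB by blast
    next
      fix T assume *: "\<forall>T. g ` T = T \<longrightarrow> T \<inter> L \<noteq> {} \<longrightarrow> L \<subseteq> T" and T: "(f \<circ> g) ` T = T" "T \<inter> L \<noteq> {}"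
      have "(f \<circ> g) ` (T \<inter> (S - A)) = T \<inter> (S - A)" using T invB inj by (simp only: image_Int)
      moreover have "g ` (T \<inter> (S - A)) \<subseteq> S - A" using permutes_image[OF g] by blast
      ultimately have "g ` (T \<inter> (S - A)) = T \<inter> (S - A)"
        using fB[of "g ` (T \<inter> (S - A))"] by (simp only: comp)
      then show "L \<subseteq> T" using *[rule_format, of "T \<inter> (S - A)"] T LB by blast
    qed
    then show ?thesis using inv by simp
  qed
  have "L \<subseteq> A \<or> L \<subseteq> S - A" if "in_same_cycle (f \<circ> g) L"
  proof (cases "A \<inter> L = {}")
    case True
    then show ?thesis using L by auto
  next
    case False
    then show ?thesis using that invA inv(3) by blast
  qed
  then show ?thesis using eqA eqB by blast
qed

text \<open>Every permutation of \<open>insert a F\<close> is \<open>transpose a b \<circ> q\<close>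
  for unique \<open>b\<close> and \<open>q\<close>, so a new point outside \<open>L\<close>
  multiplies the sum by a constant. The weight is general in order to serve both the plain count,
  with \<open>h = 1\<close>, and the signed one.\<close>

lemma sum_permutes_insert_same_cycle:
  fixes w :: "('a \<Rightarrow> 'a) \<Rightarrow> int"
  assumes F: "finite F" "a \<notin> F" and L: "L \<subseteq> F" "L \<noteq> {}"
    and w: "\<And>q b. q permutes F \<Longrightarrow> b \<in> insert a F \<Longrightarrow> w (transpose a b \<circ> q) = h b * w q"
  shows "(\<Sum>p | p permutes insert a F. w p * of_bool (in_same_cycle p L)) =
    (\<Sum>b\<in>insert a F. h b) * (\<Sum>p | p permutes F. w p * of_bool (in_same_cycle p L))"
proof -
  have "(\<Sum>p | p permutes insert a F. w p * of_bool (in_same_cycle p L)) =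
      (\<Sum>b\<in>insert a F. \<Sum>q | q permutes F.
        w (transpose a b \<circ> q) * of_bool (in_same_cycle (transpose a b \<circ> q) L))"
    by (rule sum_over_permutations_insert[OF F])
  also have "\<dots> = (\<Sum>b\<in>insert a F. \<Sum>q | q permutes F. h b * (w q * of_bool (in_same_cycle q L)))"
  proof (intro sum.cong refl)
    fix b q assume b: "b \<in> insert a F" and "q \<in> {q. q permutes F}"
    then have q: "q permutes F" by simp
    show "w (transpose a b \<circ> q) * of_bool (in_same_cycle (transpose a b \<circ> q) L) =
        h b * (w q * of_bool (in_same_cycle q L))"
      by (simp only: w[OF q b] in_same_cycle_insert[OF F L q b] mult.assoc)
  qed
  finally show ?thesis by (simp only: sum_distrib_left[symmetric] sum_distrib_right[symmetric])
qed

lemma in_same_cycle_full: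
  assumes "finite L" "L \<noteq> {}" "p permutes L"
  shows "in_same_cycle p L \<longleftrightarrow> p \<in> cycles_on L"
proof
  assume "in_same_cycle p L"
  then obtain C where C: "cyclic_on p C" "L \<subseteq> C" by (auto simp: in_same_cycle_def)
  obtain x where x: "x \<in> L" using assms(2) by auto
  then have "C = orbit p x" using C by (auto simp: cyclic_on_alldef)
  also have "\<dots> \<subseteq> L" using permutes_orbit_subset[OF assms(3) x] .
  finally show "p \<in> cycles_on L" using C assms(3) by (auto simp: cycles_on_def)
qed (auto simp: cycles_on_def in_same_cycle_def)

section \<open>Plain and signed counts of the permutations with \<open>L\<close> in one
  cycle\<close>

lemma sum_transpose_signs:
  assumes "finite F" "a \<notin> F"
  shows "(\<Sum>b\<in>insert a F. if a = b then 1 else - 1 :: int) = 1 - int (card F)"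
proof -
  have "(\<Sum>b\<in>F. if a = b then 1 else - 1 :: int) = (\<Sum>b\<in>F. - 1)"
    using assms by (intro sum.cong) auto
  then show ?thesis using assms by simp
qed

lemma sign_transpose_comp:
  assumes "finite F" "q permutes F"
  shows "sign (transpose a b \<circ> q) = (if a = b then 1 else - 1) * sign q"
proof -
  have "permutation q" using assms permutes_imp_permutation by blast
  then show ?thesis by (simp add: sign_compose permutation_swap_id sign_swap_id)
qed

lemma sum_sign_permutes:
  assumes "finite A"
  shows "(\<Sum>p | p permutes A. sign p) = of_bool (card A \<le> 1)"
  using assms
proof (induction A rule: finite_induct)
  case (insert a F)
  have "(\<Sum>p | p permutes insert a F. sign p) =
      (\<Sum>b\<in>insert a F. \<Sum>q | q permutes F. sign (transpose a b \<circ> q))"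
    by (rule sum_over_permutations_insert[OF insert(1,2)])
  also have "\<dots> = (\<Sum>b\<in>insert a F. \<Sum>q | q permutes F. (if a = b then 1 else - 1) * sign q)"
    using sign_transpose_comp[OF insert(1)] by (intro sum.cong refl) simp
  also have "\<dots> = (1 - int (card F)) * (\<Sum>q | q permutes F. sign q)"
    unfolding sum_transpose_signs[OF insert(1,2), symmetric]
    by (simp only: sum_distrib_left[symmetric] sum_distrib_right[symmetric])
  also have "\<dots> = of_bool (Suc (card F) \<le> 1)"
    unfolding insert.IH by (cases "card F \<ge> 2") (auto simp: not_le less_Suc_eq numeral_2_eq_2)
  finally show ?case using insert by simp
qed simp

lemma sum_same_cycle_base:
  assumes "finite L" "L \<noteq> {}" "\<And>c. c \<in> cycles_on L \<Longrightarrow> w c = (e :: int)"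
  shows "(\<Sum>p | p permutes L. w p * of_bool (in_same_cycle p L)) = fact (card L - 1) * e"
proof -
  have "(\<Sum>p | p permutes L. w p * of_bool (in_same_cycle p L)) = (\<Sum>p\<in>cycles_on L. e)"
    using assms finite_permutations[OF assms(1)] in_same_cycle_full[OF assms(1,2)]
    by (intro sum.mono_neutral_cong_right) (auto simp: cycles_on_def)
  then show ?thesis using card_cycles_on[OF assms(1,2)] by simp
qed

text \<open>Each point outside \<open>L\<close> multiplies the count by the new number of points, as
  it does the factorial; so \<open>L\<close> lies in one cycle of a uniform permutation with
  probability \<open>1 / card L\<close>. The equation is multiplied out to stay in the
  integers.\<close>

lemma count_same_cycle:
  assumes "finite F" "finite L" "L \<noteq> {}" "F \<inter> L = {}"
  shows "int (card L) * (\<Sum>p | p permutes F \<union> L. of_bool (in_same_cycle p L)) =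
    fact (card F + card L)"
  using assms(1,4)
proof (induction F rule: finite_induct)
  case empty
  have "(\<Sum>p | p permutes L. 1 * of_bool (in_same_cycle p L)) = fact (card L - 1) * (1 :: int)"
    by (rule sum_same_cycle_base[OF assms(2,3)]) simp
  moreover obtain m where "card L = Suc m"
    using assms(2,3) by (metis card_eq_0_iff not0_implies_Suc)
  ultimately show ?case by simp
next
  case (insert a F)
  have fin: "finite (F \<union> L)" "a \<notin> F \<union> L" using insert assms(2) by auto
  have card: "card (F \<union> L) = card F + card L"
    using insert assms(2) by (intro card_Un_disjoint) auto
  have "(\<Sum>p | p permutes insert a (F \<union> L). 1 * of_bool (in_same_cycle p L)) =
      (\<Sum>b\<in>insert a (F \<union> L). 1) * (\<Sum>p | p permutes F \<union> L. 1 * of_bool (in_same_cycle p L) :: int)"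
    by (rule sum_permutes_insert_same_cycle[OF fin]) (use assms(3) in auto)
  also have "(\<Sum>b\<in>insert a (F \<union> L). 1 :: int) = int (Suc (card F + card L))"
    using fin card by simp
  finally have "int (card L) * (\<Sum>p | p permutes insert a F \<union> L. of_bool (in_same_cycle p L)) =
      int (Suc (card F + card L)) *
        (int (card L) * (\<Sum>p | p permutes F \<union> L. of_bool (in_same_cycle p L)))"
    by (simp add: algebra_simps)
  also have "\<dots> = int (Suc (card F + card L)) * fact (card F + card L)"
    using insert by simp
  finally show ?case using insert by simp
qed

text \<open>The start is \<open>fact (card L - 1)\<close> cycles of equal sign. A point added to
  \<open>m\<close> others contributes the factor \<open>1 - m\<close>, since one choice of
  \<open>b\<close> keeps the sign and \<open>m\<close> choices reverse it; the product of these
  factors telescopes.\<close>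

lemma signed_count_same_cycle:
  assumes "finite F" "finite L" "card L \<ge> 2" "F \<inter> L = {}"
  shows "(\<Sum>p | p permutes F \<union> L. sign p * of_bool (in_same_cycle p L)) =
    (-1) ^ (card F + card L - 1) * (int (card L) - 1) * fact (card F + card L - 2)"
  using assms(1,4)
proof (induction F rule: finite_induct)
  case empty
  have L: "L \<noteq> {}" using assms(3) by auto
  have "(\<Sum>p | p permutes L. sign p * of_bool (in_same_cycle p L)) =
      fact (card L - 1) * (-1) ^ (card L - 1)"
    by (rule sum_same_cycle_base[OF assms(2) L]) (rule sign_cycles_on[OF assms(2) L])
  moreover obtain m where "card L = m + 2"
    using assms(3) by (metis add.commute le_Suc_ex)
  ultimately show ?case by simp
next
  case (insert a F)
  have fin: "finite (F \<union> L)" "a \<notin> F \<union> L" using insert assms(2) by auto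
  have card: "card (F \<union> L) = card F + card L"
    using insert assms(2) by (intro card_Un_disjoint) auto
  have "(\<Sum>p | p permutes insert a (F \<union> L). sign p * of_bool (in_same_cycle p L)) =
      (\<Sum>b\<in>insert a (F \<union> L). if a = b then 1 else - 1) *
      (\<Sum>p | p permutes F \<union> L. sign p * of_bool (in_same_cycle p L))"
    by (rule sum_permutes_insert_same_cycle[OF fin])
      (use assms(3) sign_transpose_comp[OF fin(1)] in auto)
  also have "\<dots> = (1 - int (card F + card L)) *
      ((-1) ^ (card F + card L - 1) * (int (card L) - 1) * fact (card F + card L - 2))"
    using insert unfolding sum_transpose_signs[OF fin] card by simp
  also have "\<dots> = (-1) ^ (card (insert a F) + card L - 1) * (int (card L) - 1) *
      fact (card (insert a F) + card L - 2)"
  proof -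
    obtain m where "card L = m + 2" using assms(3) by (metis add.commute le_Suc_ex)
    then show ?thesis using insert by (simp add: algebra_simps)
  qed
  finally show ?case by simp
qed

text \<open>A nonzero minor forces \<open>p\<close> to preserve \<open>A\<close>, so
  \<open>p\<close> splits into \<open>f\<close> on \<open>A\<close> and \<open>g\<close> on the
  complement, and the minor is the sign of \<open>f\<close>. If \<open>L\<close> lies in
  \<open>A\<close>, then \<open>g\<close> is free; if \<open>L\<close> lies outside, then
  \<open>f\<close> is free and its signs cancel unless \<open>card A \<le> 1\<close>. Hence degrees
  0 and 1 are treated apart from the others.\<close>

lemma sum_pminor_same_cycle:
  assumes S: "finite S" and A: "A \<subseteq> S" and L: "L \<subseteq> S" "L \<noteq> {}"
  shows "(\<Sum>p | p permutes S. pminor p A * of_bool (in_same_cycle p L)) =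
    (if L \<subseteq> A then fact (card S - card A) * (\<Sum>f | f permutes A. sign f * of_bool (in_same_cycle f L))
     else if L \<subseteq> S - A then of_bool (card A \<le> 1) * (\<Sum>g | g permutes S - A. of_bool (in_same_cycle g L))
     else 0)"
proof -
  have fin: "finite A" "finite (S - A)" using S A by (auto intro: finite_subset)
  have Sdec: "A \<union> (S - A) = S" using A by auto
  have bij: "bij_betw (\<lambda>(f, g). f \<circ> g) ({f. f permutes A} \<times> {g. g permutes (S - A)})
      {h. h permutes S \<and> h ` A = A}"
    using bij_betw_permutes_comp[of A "S - A"] Sdec by auto
  have "(\<Sum>p | p permutes S. pminor p A * of_bool (in_same_cycle p L)) =
      (\<Sum>p | p permutes S \<and> p ` A = A. pminor p A * of_bool (in_same_cycle p L))"
    using finite_permutations[OF S] by (intro sum.mono_neutral_right) (auto simp: pminor_def)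
  also have "\<dots> = (\<Sum>(f, g)\<in>{f. f permutes A} \<times> {g. g permutes (S - A)}.
      pminor (f \<circ> g) A * of_bool (in_same_cycle (f \<circ> g) L))"
    by (subst sum.reindex_bij_betw[OF bij, symmetric]) (simp add: case_prod_unfold)
  also have "\<dots> = (\<Sum>(f, g)\<in>{f. f permutes A} \<times> {g. g permutes (S - A)}.
      sign f * of_bool (L \<subseteq> A \<and> in_same_cycle f L \<or> L \<subseteq> S - A \<and> in_same_cycle g L))"
  proof (intro sum.cong refl)
    fix z assume "z \<in> {f. f permutes A} \<times> {g. g permutes (S - A)}"
    then obtain f g where z: "z = (f, g)" and fg: "f permutes A" "g permutes (S - A)" by blast
    have "pminor (f \<circ> g) A = pminor f A"
      using permutes_not_in[OF fg(2)] by (intro pminor_cong) simp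
    also have "\<dots> = sign f"
      using sign_on_permutes[OF fg(1) order_refl] permutes_image[OF fg(1)] by (simp add: pminor_def)
    finally show "(case z of (f, g) \<Rightarrow> pminor (f \<circ> g) A * of_bool (in_same_cycle (f \<circ> g) L)) =
        (case z of (f, g) \<Rightarrow>
          sign f * of_bool (L \<subseteq> A \<and> in_same_cycle f L \<or> L \<subseteq> S - A \<and> in_same_cycle g L))"
      unfolding z prod.case in_same_cycle_comp[OF S A L fg] by simp
  qed
  also have "\<dots> = (\<Sum>f | f permutes A. \<Sum>g | g permutes S - A.
      sign f * of_bool (L \<subseteq> A \<and> in_same_cycle f L \<or> L \<subseteq> S - A \<and> in_same_cycle g L))"
    using finite_permutations[OF fin(1)] finite_permutations[OF fin(2)]
    by (subst sum.cartesian_product) simp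
  finally have eq: "(\<Sum>p | p permutes S. pminor p A * of_bool (in_same_cycle p L)) =
    (\<Sum>f | f permutes A. \<Sum>g | g permutes S - A.
      sign f * of_bool (L \<subseteq> A \<and> in_same_cycle f L \<or> L \<subseteq> S - A \<and> in_same_cycle g L))" .
  consider "L \<subseteq> A" "\<not> L \<subseteq> S - A" | "\<not> L \<subseteq> A" "L \<subseteq> S - A" | "\<not> L \<subseteq> A" "\<not> L \<subseteq> S - A"
    using L by blast
  then show ?thesis
  proof cases
    case 1
    have "card {g. g permutes S - A} = fact (card S - card A)"
      using card_permutations[OF refl fin(2)] by (simp add: card_Diff_subset A fin)
    then have "(\<Sum>f | f permutes A. \<Sum>g | g permutes S - A. sign f * of_bool (in_same_cycle f L)) =
        fact (card S - card A) * (\<Sum>f | f permutes A. sign f * of_bool (in_same_cycle f L))"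
      by (simp add: sum_distrib_left)
    then show ?thesis unfolding eq using 1 by simp
  next
    case 2
    have "(\<Sum>f | f permutes A. \<Sum>g | g permutes S - A. sign f * of_bool (in_same_cycle g L)) =
        (\<Sum>f | f permutes A. sign f) * (\<Sum>g | g permutes S - A. of_bool (in_same_cycle g L))"
      by (simp only: sum_product)
    then show ?thesis unfolding eq using 2 sum_sign_permutes[OF fin(1)] by simp
  next
    case 3
    then show ?thesis unfolding eq by simp
  qed
qed

section \<open>Sums of traces and hook characters over the permutations with \<open>L\<close> in one
  cycle\<close>

definition same_cycle_sum :: "'a set \<Rightarrow> 'a set \<Rightarrow> (('a \<Rightarrow> 'a) \<Rightarrow> int) \<Rightarrow> int" where
  "same_cycle_sum S L f = (\<Sum>p | p permutes S. f p * of_bool (in_same_cycle p L))"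

lemma same_cycle_sum_ext_trace:
  "same_cycle_sum S L (ext_trace S r) =
    (\<Sum>A | A \<subseteq> S \<and> card A = r. \<Sum>p | p permutes S. pminor p A * of_bool (in_same_cycle p L))"
  unfolding same_cycle_sum_def ext_trace_def sum_distrib_right by (rule sum.swap)

text \<open>Since \<open>card A \<le> 1 < card L\<close>, only the sets \<open>A\<close> disjoint
  from \<open>L\<close> contribute, and each gives the same plain count on
  \<open>S - A\<close>.\<close>

lemma same_cycle_sum_ext_trace_le_1:
  assumes S: "finite S" and L: "L \<subseteq> S" "card L \<ge> 2" and r: "r \<le> 1"
  shows "int (card L) * same_cycle_sum S L (ext_trace S r) =
    int (card S - card L choose r) * fact (card S - r)"
proof -
  have L0: "L \<noteq> {}" and fL: "finite L" using L S by (auto intro: finite_subset)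
  have fin: "finite A" if "A \<subseteq> S" for A using that S by (rule finite_subset)
  have "int (card L) * same_cycle_sum S L (ext_trace S r) =
      (\<Sum>A | A \<subseteq> S \<and> card A = r. if L \<subseteq> S - A then fact (card S - r) else 0)"
    unfolding same_cycle_sum_ext_trace
  proof (subst sum_distrib_left, intro sum.cong refl)
    fix A assume "A \<in> {A. A \<subseteq> S \<and> card A = r}"
    then have A: "A \<subseteq> S" "card A = r" by auto
    have "\<not> L \<subseteq> A" using card_mono[OF fin[OF A(1)], of L] A L r by auto
    moreover have "int (card L) * (\<Sum>g | g permutes S - A. of_bool (in_same_cycle g L)) =
        fact (card S - r)" if "L \<subseteq> S - A"
    proof -
      have "S - A - L \<union> L = S - A" using that by auto
      moreover have "card (S - A - L) + card L = card S - r"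
        using that A S fin[OF A(1)] fL card_mono[of "S - A" L]
        by (simp add: card_Diff_subset)
      ultimately show ?thesis
        using count_same_cycle[of "S - A - L" L] S fL L0 by auto
    qed
    ultimately show "int (card L) * (\<Sum>p | p permutes S. pminor p A * of_bool (in_same_cycle p L)) =
        (if L \<subseteq> S - A then fact (card S - r) else 0)"
      using A r unfolding sum_pminor_same_cycle[OF S A(1) L(1) L0] by simp
  qed
  also have "\<dots> = (\<Sum>A | A \<subseteq> S - L \<and> card A = r. fact (card S - r))"
    using S by (intro sum.mono_neutral_cong_right) (use L in auto)
  also have "\<dots> = int (card S - card L choose r) * fact (card S - r)"
    using n_subsets[of "S - L" r] S L fL by (simp add: card_Diff_subset)
  finally show ?thesis .
qed

lemma card_supersets:
  assumes "finite S" "L \<subseteq> S" "card L \<le> r"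
  shows "card {A. A \<subseteq> S \<and> card A = r \<and> L \<subseteq> A} = (card S - card L choose (r - card L))"
proof -
  have fL: "finite L" using assms finite_subset by blast
  have "bij_betw (\<lambda>B. B \<union> L) {B. B \<subseteq> S - L \<and> card B = r - card L} {A. A \<subseteq> S \<and> card A = r \<and> L \<subseteq> A}"
  proof (rule bij_betw_byWitness[where f' = "\<lambda>A. A - L"])
    show "(\<lambda>B. B \<union> L) ` {B. B \<subseteq> S - L \<and> card B = r - card L} \<subseteq> {A. A \<subseteq> S \<and> card A = r \<and> L \<subseteq> A}"
    proof (rule image_subsetI)
      fix B assume B: "B \<in> {B. B \<subseteq> S - L \<and> card B = r - card L}"
      then have "card (B \<union> L) = card B + card L"
        using assms fL by (intro card_Un_disjoint) (auto intro: finite_subset)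
      then show "B \<union> L \<in> {A. A \<subseteq> S \<and> card A = r \<and> L \<subseteq> A}" using B assms by auto
    qed
    show "(\<lambda>A. A - L) ` {A. A \<subseteq> S \<and> card A = r \<and> L \<subseteq> A} \<subseteq> {B. B \<subseteq> S - L \<and> card B = r - card L}"
      using fL by (auto simp: card_Diff_subset)
  qed auto
  from bij_betw_same_card[OF this] show ?thesis
    using n_subsets[of "S - L" "r - card L"] assms fL by (simp add: card_Diff_subset)
qed

lemma binomial_mult_fact:
  "of_nat (a + b choose a) * fact a * fact b = (fact (a + b) :: 'a :: linordered_idom)"
proof -
  have "(a + b choose a) * fact a * fact b = fact (a + b)"
    using binomial_fact_lemma[of a "a + b"] by (simp add: ac_simps)
  then have "of_nat ((a + b choose a) * fact a * fact b) = (of_nat (fact (a + b)) :: 'a)" by simp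
  then show ?thesis by simp
qed

text \<open>After multiplication by \<open>fact s\<close>, both sides are
  \<open>fact (s + t) * (m + 1) * fact (m + s)\<close>. In the application
  \<open>m + 2 = card L\<close>, while \<open>s\<close> and \<open>t\<close> are the sizes of
  \<open>A - L\<close> and \<open>S - A\<close>.\<close>

lemma binomial_fact_identity:
  "int (s + t choose s) * fact t * (int m + 1) * fact (m + s) =
    fact (m + 1) * fact (s + t) * int (m + s choose m)"
proof -
  have 1: "int (s + t choose s) * fact s * fact t = fact (s + t)"
    by (rule binomial_mult_fact)
  have 2: "int (m + s choose m) * fact m * fact s = fact (m + s)"
    by (rule binomial_mult_fact)
  have "fact s * (int (s + t choose s) * fact t * (int m + 1) * fact (m + s)) =
      (int (s + t choose s) * fact s * fact t) * (int m + 1) * fact (m + s)"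
    by (simp only: ac_simps)
  also have "\<dots> = fact (s + t) * (int m + 1) * (int (m + s choose m) * fact m * fact s)"
    unfolding 1 2 ..
  also have "\<dots> = fact s * (fact (m + 1) * fact (s + t) * int (m + s choose m))"
    by (simp add: algebra_simps)
  finally show ?thesis by simp
qed

text \<open>From degree 2 on, only the sets \<open>A\<close> that contain \<open>L\<close>
  contribute, all with the same value \<open>v\<close>. The offset 2 matches the factorial of
  \<open>card A - 2\<close> in the signed count.\<close>

lemma same_cycle_sum_ext_trace_ge_2:
  assumes S: "finite S" and L: "L \<subseteq> S" "card L \<ge> 2" and r: "r + 2 \<le> card S"
  shows "same_cycle_sum S L (ext_trace S (r + 2)) =
    (-1) ^ (r + 1) * (fact (card L - 1) * fact (card S - card L)) * int (r choose (card L - 2))"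
proof -
  have L0: "L \<noteq> {}" and fL: "finite L" using L S by (auto intro: finite_subset)
  have fin: "finite A" if "A \<subseteq> S" for A using that S by (rule finite_subset)
  define v where "v = fact (card S - (r + 2)) * ((-1) ^ (r + 1) * (int (card L) - 1) * fact r)"
  have "same_cycle_sum S L (ext_trace S (r + 2)) =
      (\<Sum>A | A \<subseteq> S \<and> card A = r + 2. if L \<subseteq> A then v else 0)"
    unfolding same_cycle_sum_ext_trace
  proof (intro sum.cong refl)
    fix A assume "A \<in> {A. A \<subseteq> S \<and> card A = r + 2}"
    then have A: "A \<subseteq> S" "card A = r + 2" by auto
    have "(\<Sum>f | f permutes A. sign f * of_bool (in_same_cycle f L)) =
        (-1) ^ (r + 1) * (int (card L) - 1) * fact r" if "L \<subseteq> A"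
    proof -
      have "A - L \<union> L = A" using that by auto
      moreover have "card (A - L) + card L = r + 2"
        using that A fin[OF A(1)] fL card_mono[of A L] by (simp add: card_Diff_subset)
      ultimately show ?thesis
        using signed_count_same_cycle[of "A - L" L] fin[OF A(1)] fL L by auto
    qed
    then show "(\<Sum>p | p permutes S. pminor p A * of_bool (in_same_cycle p L)) =
        (if L \<subseteq> A then v else 0)"
      using A unfolding sum_pminor_same_cycle[OF S A(1) L(1) L0] v_def by auto
  qed
  also have "\<dots> = (\<Sum>A | A \<subseteq> S \<and> card A = r + 2 \<and> L \<subseteq> A. v)"
    using S by (intro sum.mono_neutral_cong_right) auto
  also have "\<dots> = int (card {A. A \<subseteq> S \<and> card A = r + 2 \<and> L \<subseteq> A}) * v" by simp
  finally have eq: "same_cycle_sum S L (ext_trace S (r + 2)) =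
    int (card {A. A \<subseteq> S \<and> card A = r + 2 \<and> L \<subseteq> A}) * v" .
  show ?thesis
  proof (cases "card L \<le> r + 2")
    case False
    then have "\<not> L \<subseteq> A" if "A \<subseteq> S" "card A = r + 2" for A
      using card_mono[OF fin[OF that(1)], of L] that by auto
    then have none: "{A. A \<subseteq> S \<and> card A = r + 2 \<and> L \<subseteq> A} = {}" by blast
    show ?thesis unfolding eq none using False by simp
  next
    case True
    obtain m where m: "card L = m + 2" using L(2) by (metis add.commute le_Suc_ex)
    obtain s where s: "r = m + s" using True m by (metis add_le_cancel_right le_Suc_ex)
    obtain t where t: "card S = s + t + m + 2"
      using r s by (metis add.assoc add.commute le_Suc_ex)
    have "same_cycle_sum S L (ext_trace S (r + 2)) = int (s + t choose s) * v"
      unfolding eq card_supersets[OF S L(1) True] by (simp add: m s t)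
    also have "v = fact t * ((-1) ^ (r + 1) * (int m + 1) * fact (m + s))"
      unfolding v_def by (simp add: m s t)
    also have "int (s + t choose s) * \<dots> =
        (-1) ^ (r + 1) * (int (s + t choose s) * fact t * (int m + 1) * fact (m + s))"
      by (simp only: ac_simps)
    also have "\<dots> = (-1) ^ (r + 1) * (fact (m + 1) * fact (s + t) * int (m + s choose m))"
      unfolding binomial_fact_identity ..
    finally show ?thesis by (simp only: m s t) simp
  qed
qed

lemma same_cycle_sum_hook_char_Suc:
  "same_cycle_sum S L (hook_char S (Suc r)) =
    same_cycle_sum S L (ext_trace S (Suc r)) - same_cycle_sum S L (hook_char S r)"
  unfolding same_cycle_sum_def by (simp add: sum_subtractf left_diff_distrib)

lemma same_cycle_sum_hook_char_0:
  assumes "finite S" "L \<subseteq> S" "card L \<ge> 2"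
  shows "int (card L) * same_cycle_sum S L (hook_char S 0) = fact (card S)"
  using same_cycle_sum_ext_trace_le_1[OF assms, of 0] by (simp add: same_cycle_sum_def)

text \<open>Degree 0 is left out because the sum there is \<open>fact (card S) / card L\<close>, of
  another form; this is why the first row of length \<open>N\<close> has its own term in the
  theorem. The base case, degree 1, produces the constant
  \<open>card S - 1 choose (card L - 1)\<close>. Each further degree brings in
  \<open>r choose (card L - 2)\<close>, which Pascal's rule absorbs into the second
  binomial.\<close>

lemma same_cycle_sum_hook_char:
  assumes S: "finite S" and L: "L \<subseteq> S" "card L \<ge> 2" and r: "r < card S"
  shows "same_cycle_sum S L (hook_char S (Suc r)) =
    (-1) ^ Suc r * (fact (card L - 1) * fact (card S - card L)) *
      (int (card S - 1 choose (card L - 1)) - int (r choose (card L - 1)))"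
  using r
proof (induction r)
  case 0
  have le: "card L \<le> card S" using L S by (auto intro: card_mono)
  obtain m where m: "card L = Suc (Suc m)" using L(2) by (metis add_2_eq_Suc le_Suc_ex)
  obtain t where t: "card S = Suc (Suc (m + t))" using le m by (metis add_Suc le_Suc_ex)
  have "int (card L) * same_cycle_sum S L (hook_char S (Suc 0)) =
      int t * fact (Suc (m + t)) - fact (Suc (Suc (m + t)))"
    using same_cycle_sum_ext_trace_le_1[OF S L, of 1] same_cycle_sum_hook_char_0[OF S L]
    unfolding same_cycle_sum_hook_char_Suc right_diff_distrib by (simp add: m t)
  \<comment> \<open>With \<open>n = card S\<close> and \<open>l = card L\<close>, this is
    \<open>(n - l) (n - 1)! - n! = - l (n - 1)!\<close>.\<close>
  also have "\<dots> = - (int (card L) * fact (Suc (m + t)))"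
    by (simp add: m algebra_simps)
  finally have "int (card L) * same_cycle_sum S L (hook_char S (Suc 0)) =
      int (card L) * (- fact (Suc (m + t)))" by simp
  then have "same_cycle_sum S L (hook_char S (Suc 0)) = - fact (Suc (m + t))"
    using L(2) by (subst (asm) mult_left_cancel) auto
  moreover have "fact (Suc m) * fact t * int (Suc (m + t) choose Suc m) = fact (Suc (m + t))"
    using binomial_mult_fact[of "Suc m" t, where 'a = int] by (simp add: ac_simps)
  ultimately show ?case
    by (simp add: m t del: hook_char.simps binomial_Suc_Suc fact_Suc)
next
  case (Suc r)
  define D where "D = (fact (card L - 1) * fact (card S - card L) :: int)"
  obtain m where m: "card L = Suc (Suc m)" using L(2) by (metis add_2_eq_Suc le_Suc_ex)
  have IH: "same_cycle_sum S L (hook_char S (Suc r)) =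
      (-1) ^ Suc r * D * (int (card S - 1 choose (card L - 1)) - int (r choose Suc m))"
    using Suc by (simp add: D_def m del: hook_char.simps)
  have "same_cycle_sum S L (ext_trace S (Suc (Suc r))) = (-1) ^ (r + 1) * D * int (r choose m)"
    using same_cycle_sum_ext_trace_ge_2[OF S L, of r] Suc.prems by (simp add: D_def m)
  then have "same_cycle_sum S L (hook_char S (Suc (Suc r))) =
      (-1) ^ (r + 1) * D * int (r choose m) -
      (-1) ^ Suc r * D * (int (card S - 1 choose (card L - 1)) - int (r choose Suc m))"
    unfolding same_cycle_sum_hook_char_Suc[of S L "Suc r"] IH by simp
  also have "\<dots> = (-1) ^ Suc (Suc r) * D *
      (int (card S - 1 choose (card L - 1)) - int (Suc r choose Suc m))"
    by (simp add: algebra_simps)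
  finally show ?case by (simp add: D_def m del: hook_char.simps binomial_Suc_Suc)
qed

subsection \<open>The distribution of the product\<close>

lemma perm_product_0: "perm_product 0 p = id"
  by (simp add: perm_product_def)

lemma perm_product_Suc: "perm_product (Suc k) p = perm_product k p \<circ> p (Suc k)"
proof -
  have "foldr (\<circ>) xs f = foldr (\<circ>) xs id \<circ> f" for xs :: "('a \<Rightarrow> 'a) list" and f
    by (induction xs) (simp_all add: o_assoc)
  then have "foldr (\<circ>) (map p [1..<Suc k]) (p (Suc k)) = foldr (\<circ>) (map p [1..<Suc k]) id \<circ> p (Suc k)" .
  then show ?thesis by (simp add: perm_product_def)
qed

lemma perm_product_upd: "perm_product k (p(Suc k := c)) = perm_product k p"
proof -
  have "map (p(Suc k := c)) [1..<Suc k] = map p [1..<Suc k]" by (intro map_cong refl) auto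
  then show ?thesis unfolding perm_product_def by metis
qed

definition product_pmf :: "nat \<Rightarrow> nat \<Rightarrow> (nat \<Rightarrow> nat) pmf" where
  "product_pmf N k = map_pmf (perm_product k) (long_cycle_tuple N k)"

lemma product_pmf_0: "product_pmf N 0 = return_pmf id"
  by (simp add: product_pmf_def long_cycle_tuple_def perm_product_0 map_pmf_const)

lemma product_pmf_Suc:
  "product_pmf N (Suc k) =
    bind_pmf (pmf_of_set (long_cycles N)) (\<lambda>c. map_pmf (\<lambda>s. s \<circ> c) (product_pmf N k))"
proof -
  have ins: "{1..Suc k} = insert (Suc k) {1..k}" by auto
  have "long_cycle_tuple N (Suc k) =
      map_pmf (\<lambda>(c, p). p(Suc k := c)) (pair_pmf (pmf_of_set (long_cycles N)) (long_cycle_tuple N k))"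
    unfolding long_cycle_tuple_def ins by (rule Pi_pmf_insert) auto
  then have "product_pmf N (Suc k) = map_pmf (\<lambda>(c, p). perm_product k p \<circ> c)
      (pair_pmf (pmf_of_set (long_cycles N)) (long_cycle_tuple N k))"
    by (simp add: product_pmf_def map_pmf_comp perm_product_Suc perm_product_upd case_prod_unfold)
  also have "\<dots> = bind_pmf (pmf_of_set (long_cycles N))
      (\<lambda>c. map_pmf (\<lambda>s. s \<circ> c) (product_pmf N k))"
    by (simp add: pair_pmf_def product_pmf_def map_pmf_def bind_assoc_pmf bind_return_pmf)
  finally show ?thesis .
qed

section \<open>From the eigenvalues to the point probabilities of the product\<close>

lemma long_cycles_eq: "long_cycles N = cycles_on {1..N}"
  by (simp add: long_cycles_def cycles_on_def)

lemma inv_cycles_on: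
  assumes "finite S" "c \<in> cycles_on S"
  shows "inv c \<in> cycles_on S"
proof -
  have "c permutes S" "cyclic_on c S" using assms by (auto simp: cycles_on_def)
  moreover have "permutation c" using calculation assms permutes_imp_permutation by blast
  ultimately show ?thesis
    by (simp add: cycles_on_def permutes_inv cyclic_on_def orbit_inv_eq)
qed

lemma card_long_cycles:
  assumes "N \<ge> 1"
  shows "card (long_cycles N) = fact (N - 1)" "finite (long_cycles N)" "long_cycles N \<noteq> {}"
proof -
  show c: "card (long_cycles N) = fact (N - 1)"
    using assms card_cycles_on[of "{1..N}"] by (simp add: long_cycles_eq)
  show "finite (long_cycles N)" by (simp add: long_cycles_eq finite_cycles_on)
  show "long_cycles N \<noteq> {}" using c by (metis card.empty fact_nonzero)
qed

lemma set_product_pmf: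
  assumes "N \<ge> 1"
  shows "set_pmf (product_pmf N k) \<subseteq> {p. p permutes {1..N}}"
proof (induction k)
  case 0
  then show ?case by (simp add: product_pmf_0)
next
  case (Suc k)
  then show ?case
    using card_long_cycles[OF assms]
    by (auto simp: product_pmf_Suc set_pmf_of_set long_cycles_def intro!: permutes_compose)
qed

text \<open>Given the last factor \<open>c\<close>, the product is \<open>p\<close> iff the earlier
  factors multiply to \<open>p \<circ> inv c\<close>. Inversion permutes the long cycles, so
  \<open>inv c\<close> may be replaced by \<open>c\<close> in the sum.\<close>

lemma pmf_product_pmf_Suc:
  assumes N: "N \<ge> 1"
  shows "pmf (product_pmf N (Suc k)) p =
    (\<Sum>c\<in>cycles_on {1..N}. pmf (product_pmf N k) (p \<circ> c)) / fact (N - 1)"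
proof -
  let ?S = "{1..N}"
  have bij: "bij_betw inv (cycles_on ?S) (cycles_on ?S)"
  proof (rule bij_betw_byWitness[where f' = inv])
    have "inv (inv c) = c" if "c \<in> cycles_on ?S" for c
      using that permutes_bij[of c ?S] by (simp add: cycles_on_def inv_inv_eq)
    then show "\<forall>c\<in>cycles_on ?S. inv (inv c) = c" "\<forall>c\<in>cycles_on ?S. inv (inv c) = c" by auto
    show "inv ` cycles_on ?S \<subseteq> cycles_on ?S" "inv ` cycles_on ?S \<subseteq> cycles_on ?S"
      using inv_cycles_on[of ?S] by blast+
  qed
  have "pmf (product_pmf N (Suc k)) p =
      (\<Sum>c\<in>cycles_on ?S. pmf (map_pmf (\<lambda>s. s \<circ> c) (product_pmf N k)) p) / fact (N - 1)"
    unfolding product_pmf_Suc using card_long_cycles[OF N]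
    by (subst pmf_bind_pmf_of_set) (simp_all add: long_cycles_eq)
  also have "(\<Sum>c\<in>cycles_on ?S. pmf (map_pmf (\<lambda>s. s \<circ> c) (product_pmf N k)) p) =
      (\<Sum>c\<in>cycles_on ?S. pmf (product_pmf N k) (p \<circ> inv c))"
  proof (intro sum.cong refl)
    fix c assume "c \<in> cycles_on ?S"
    then have c: "c permutes ?S" by (simp add: cycles_on_def)
    have "inj (\<lambda>s :: nat \<Rightarrow> nat. s \<circ> c)"
      using permutes_surj[OF c] by (auto simp: inj_def comp_def fun_eq_iff) (metis surjD)
    moreover have "(p \<circ> inv c) \<circ> c = p" using permutes_inv_o(2)[OF c] by (simp add: o_assoc[symmetric])
    ultimately show "pmf (map_pmf (\<lambda>s. s \<circ> c) (product_pmf N k)) p =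
        pmf (product_pmf N k) (p \<circ> inv c)"
      using pmf_map_inj'[of "\<lambda>s. s \<circ> c" "product_pmf N k" "p \<circ> inv c"] by metis
  qed
  also have "\<dots> = (\<Sum>c\<in>cycles_on ?S. pmf (product_pmf N k) (p \<circ> c))"
    using sum.reindex_bij_betw[OF bij, of "\<lambda>c. pmf (product_pmf N k) (p \<circ> c)"] by simp
  finally show ?thesis .
qed

text \<open>The first long cycle contributes only the expansion of its uniform distribution into
  hook characters; each of the \<open>k\<close> others multiplies the \<open>r\<close>-th term by
  its eigenvalue. With one factor fewer in the count, this becomes the exponent \<open>1 - k\<close>
  of the theorem.\<close>

lemma pmf_product_pmf:
  assumes N: "N \<ge> 1" and p: "p permutes {1..N}"
  shows "pmf (product_pmf N (Suc k)) p =
    (\<Sum>r<N. (-1) ^ r * ((-1) ^ r / real (N - 1 choose r)) ^ k * of_int (hook_char {1..N} r p)) / fact N"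
  using p
proof (induction k arbitrary: p)
  case 0
  have fN: "fact N = real N * fact (N - 1)" using N by (simp add: fact_reduce)
  have "product_pmf N (Suc 0) = pmf_of_set (long_cycles N)"
    by (simp add: product_pmf_Suc product_pmf_0 bind_return_pmf' )
  then have "pmf (product_pmf N (Suc 0)) p = of_bool (p \<in> cycles_on {1..N}) / fact (N - 1)"
    using card_long_cycles[OF N] by (simp add: long_cycles_eq indicator_def)
  also have "\<dots> = of_int (int N * of_bool (p \<in> cycles_on {1..N})) / fact N"
    using N by (simp add: fN)
  also have "int N * of_bool (p \<in> cycles_on {1..N}) = (\<Sum>r<N. (-1) ^ r * hook_char {1..N} r p)"
    using sum_alternating_hook_char[OF _ 0] by simp
  finally show ?case by simp
next
  case (Suc k)
  let ?S = "{1..N}"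
  define a where "a r = (-1) ^ r / real (N - 1 choose r)" for r
  have eig: "(\<Sum>c\<in>cycles_on ?S. of_int (hook_char ?S r (p \<circ> c))) / fact (N - 1) =
      a r * of_int (hook_char ?S r p)" if r: "r < N" for r
  proof -
    have "(\<Sum>c\<in>cycles_on ?S. of_int (hook_char ?S r (p \<circ> c))) =
        (of_int ((-1) ^ r * fact r * fact (N - 1 - r) * hook_char ?S r p) :: real)"
      using sum_cycles_hook_char[OF _ Suc.prems, of r] r by (simp flip: of_int_sum)
    moreover have "real (N - 1 choose r) = fact (N - 1) / (fact r * fact (N - 1 - r))"
      using r by (intro binomial_fact) auto
    ultimately show ?thesis by (simp add: a_def)
  qed
  have "pmf (product_pmf N (Suc (Suc k))) p =
      (\<Sum>c\<in>cycles_on ?S. pmf (product_pmf N (Suc k)) (p \<circ> c)) / fact (N - 1)"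
    by (rule pmf_product_pmf_Suc[OF N])
  also have "\<dots> = (\<Sum>c\<in>cycles_on ?S.
      (\<Sum>r<N. (-1) ^ r * a r ^ k * of_int (hook_char ?S r (p \<circ> c))) / fact N) / fact (N - 1)"
    using Suc.prems
    by (intro sum.cong arg_cong2[where f = "(/)"] refl, subst Suc.IH)
      (auto simp: cycles_on_def a_def intro: permutes_compose)
  also have "\<dots> = (\<Sum>c\<in>cycles_on ?S. \<Sum>r<N. (-1) ^ r * a r ^ k * of_int (hook_char ?S r (p \<circ> c)))
      / fact (N - 1) / fact N"
    by (simp add: sum_divide_distrib[symmetric] mult.commute)
  also have "(\<Sum>c\<in>cycles_on ?S. \<Sum>r<N. (-1) ^ r * a r ^ k * of_int (hook_char ?S r (p \<circ> c))) =
      (\<Sum>r<N. (-1) ^ r * a r ^ k * (\<Sum>c\<in>cycles_on ?S. of_int (hook_char ?S r (p \<circ> c))))"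
    unfolding sum_distrib_left by (rule sum.swap)
  also have "\<dots> / fact (N - 1) =
      (\<Sum>r<N. (-1) ^ r * a r ^ k * ((\<Sum>c\<in>cycles_on ?S. of_int (hook_char ?S r (p \<circ> c))) / fact (N - 1)))"
    by (simp only: sum_divide_distrib[of _ "{..<N}"] times_divide_eq_right)
  also have "\<dots> = (\<Sum>r<N. (-1) ^ r * a r ^ Suc k * of_int (hook_char ?S r p))"
    using eig by (intro sum.cong refl) simp
  finally show ?case unfolding a_def .
qed

lemma p_A2_eq_same_cycle_sum:
  assumes N: "N \<ge> 1"
  shows "p_A2 N l (Suc k) =
    (\<Sum>r<N. (-1) ^ r * ((-1) ^ r / real (N - 1 choose r)) ^ k *
      of_int (same_cycle_sum {1..N} {1..l} (hook_char {1..N} r))) / fact N"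
proof -
  let ?S = "{1..N}"
  let ?X = "{p. p permutes ?S}"
  define h where "h r = (-1) ^ r * ((-1) ^ r / real (N - 1 choose r)) ^ k" for r
  have fin: "finite ?X" by (rule finite_permutations) simp
  have "p_A2 N l (Suc k) = measure_pmf.prob (product_pmf N (Suc k)) {p. in_same_cycle p {1..l}}"
    by (simp add: p_A2_def product_pmf_def vimage_def)
  \<comment> \<open>The product is almost surely a permutation of \<open>{1..N}\<close>;
    intersecting with these makes the event finite.\<close>
  also have "\<dots> = measure_pmf.prob (product_pmf N (Suc k)) {p \<in> ?X. in_same_cycle p {1..l}}"
    using set_product_pmf[OF N, of "Suc k"]
    by (intro measure_pmf.finite_measure_eq_AE) (auto simp: AE_measure_pmf_iff)
  also have "\<dots> = (\<Sum>p | p \<in> ?X \<and> in_same_cycle p {1..l}. pmf (product_pmf N (Suc k)) p)"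
    using fin by (intro measure_measure_pmf_finite) simp
  also have "\<dots> = (\<Sum>p\<in>?X. pmf (product_pmf N (Suc k)) p * of_bool (in_same_cycle p {1..l}))"
    using fin by (intro sum.mono_neutral_cong_left) auto
  also have "\<dots> = (\<Sum>p\<in>?X. (\<Sum>r<N. h r * of_int (hook_char ?S r p) * of_bool (in_same_cycle p {1..l})) / fact N)"
    using pmf_product_pmf[OF N, of _ k] by (intro sum.cong refl) (simp add: h_def sum_distrib_right)
  also have "\<dots> = (\<Sum>p\<in>?X. \<Sum>r<N. h r * of_int (hook_char ?S r p) * of_bool (in_same_cycle p {1..l})) / fact N"
    by (simp add: sum_divide_distrib)
  also have "(\<Sum>p\<in>?X. \<Sum>r<N. h r * of_int (hook_char ?S r p) * of_bool (in_same_cycle p {1..l})) =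
      (\<Sum>r<N. \<Sum>p\<in>?X. h r * of_int (hook_char ?S r p) * of_bool (in_same_cycle p {1..l}))"
    by (rule sum.swap)
  also have "\<dots> = (\<Sum>r<N. h r * of_int (same_cycle_sum ?S {1..l} (hook_char ?S r)))"
    by (simp add: same_cycle_sum_def sum_distrib_left mult.assoc)
  finally show ?thesis unfolding h_def .
qed

theorem theorem4p5:
  fixes N l k :: nat
  assumes "N \<ge> l" and "l \<ge> 2" and "k \<ge> 1"
  shows "p_A2 N l k =
    1 / real l * inverse (real (N choose l)) *
    (\<Sum>j = 1..N.
       (-1) ^ ((k + 1) * (N - j)) *
       real ((N - 1) choose (j - 1)) powi (1 - int k) *
       (of_bool (j < N) *
          (real ((N - 1) choose (l - 1)) - real ((N - j - 1) choose (l - 1))) +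
        of_bool (j = N) * real (N choose l)))"
proof -
  obtain m where k: "k = Suc m" using assms(3) by (cases k) auto
  have N: "N \<ge> 1" using assms by simp
  let ?S = "{1..N}" and ?L = "{1..l}"
  have L: "finite ?S" "?L \<subseteq> ?S" "card ?L \<ge> 2" using assms by auto
  define C where "C = real (N choose l)"
  have C0: "C > 0" using assms(1) by (simp add: C_def zero_less_binomial)
  have fl: "fact l = real l * fact (l - 1)" using assms by (simp add: fact_reduce)
  have CN: "C * (real l * (fact (l - 1) * fact (N - l))) = fact N"
    using binomial_mult_fact[of l "N - l", where 'a = real] assms(1)
    unfolding C_def fl by (simp add: ac_simps)
  have summand: "(-1) ^ r * ((-1) ^ r / real (N - 1 choose r)) ^ m *
      of_int (same_cycle_sum ?S ?L (hook_char ?S r)) / fact N =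
      1 / real l * inverse C * ((-1) ^ ((k + 1) * (N - j)) *
       real ((N - 1) choose (j - 1)) powi (1 - int k) *
       (of_bool (j < N) *
          (real ((N - 1) choose (l - 1)) - real ((N - j - 1) choose (l - 1))) +
        of_bool (j = N) * C))"
    if j: "1 \<le> j" "j \<le> N" and r: "r = N - j" for j r
  proof -
    have "(N - 1 choose (j - 1)) = (N - 1 choose (N - 1 - (j - 1)))"
      using j by (intro binomial_symmetric) simp
    also have "N - 1 - (j - 1) = r" using j r by simp
    finally have bin: "(N - 1 choose (j - 1)) = (N - 1 choose r)" .
    have pw: "real (N - 1 choose r) powi (1 - int k) = inverse (real (N - 1 choose r) ^ m)"
      by (simp add: k power_int_minus)
    have main: "of_int (same_cycle_sum ?S ?L (hook_char ?S r)) / fact N =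
      1 / real l * inverse C * ((-1) ^ r * (of_bool (j < N) *
          (real ((N - 1) choose (l - 1)) - real ((N - j - 1) choose (l - 1))) +
        of_bool (j = N) * C))"
    proof (cases r)
      case 0
      have "real_of_int (int l * same_cycle_sum ?S ?L (hook_char ?S r)) = of_int (fact N)"
        using same_cycle_sum_hook_char_0[OF L] 0 by simp
      then have "real l * of_int (same_cycle_sum ?S ?L (hook_char ?S r)) = fact N" by simp
      then have "of_int (same_cycle_sum ?S ?L (hook_char ?S r)) / fact N = 1 / real l"
        using assms by (simp add: field_simps)
      moreover have "j = N" using 0 r j by simp
      ultimately show ?thesis using C0 0 by simp
    next
      case (Suc q)
      have q: "q = N - j - 1" "j < N" "q < N" using Suc r by auto
      have "same_cycle_sum ?S ?L (hook_char ?S r) =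
        (-1) ^ r * (fact (l - 1) * fact (N - l)) * (int (N - 1 choose (l - 1)) - int (q choose (l - 1)))"
        using same_cycle_sum_hook_char[OF L, of q] q Suc by simp
      then have "of_int (same_cycle_sum ?S ?L (hook_char ?S r)) / fact N =
        (-1) ^ r * (fact (l - 1) * fact (N - l)) *
          (real (N - 1 choose (l - 1)) - real (q choose (l - 1))) / fact N" by simp
      also have "\<dots> = 1 / real l * inverse C * ((-1) ^ r *
          (real (N - 1 choose (l - 1)) - real (q choose (l - 1))))"
        unfolding CN[symmetric] using C0 assms by (simp add: field_simps)
      finally show ?thesis using q by simp
    qed
    have sg: "(-1) ^ r * ((-1) ^ r) ^ m * (-1) ^ r = ((-1) ^ ((k + 1) * r) :: real)"
      by (simp add: k power_add power_mult[symmetric] mult.commute)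
    show ?thesis
      unfolding bin pw times_divide_eq_right[symmetric] main
      unfolding r[symmetric] sg[symmetric] power_divide by (simp add: field_simps)
  qed
  have "p_A2 N l k = (\<Sum>r<N. (-1) ^ r * ((-1) ^ r / real (N - 1 choose r)) ^ m *
      of_int (same_cycle_sum ?S ?L (hook_char ?S r)) / fact N)"
    unfolding k p_A2_eq_same_cycle_sum[OF N] by (rule sum_divide_distrib)
  also have "\<dots> = (\<Sum>j = 1..N. 1 / real l * inverse C * ((-1) ^ ((k + 1) * (N - j)) *
       real ((N - 1) choose (j - 1)) powi (1 - int k) *
       (of_bool (j < N) *
          (real ((N - 1) choose (l - 1)) - real ((N - j - 1) choose (l - 1))) +
        of_bool (j = N) * C)))"
  proof (rule sum.reindex_bij_witness[where i = "\<lambda>j. N - j" and j = "\<lambda>r. N - r"], goal_cases)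
    case (5 r)
    then show ?case using summand[of "N - r" r] by simp
  qed auto
  finally show ?thesis by (simp only: sum_distrib_left C_def)
qed

end
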